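(* Let $K$ be a simplicial complex with vertex set $V$. The map $\varphi\colon|\mathrm{Sing}(K)|\to|K|$ from the geometric realization of the simplicial set $\mathrm{Sing}(K)$ to the geometric realization of $K$, determined by sending the class of $(a,t)\in\mathrm{Sing}(K)_m\times\Delta^m$ to the function $a_*(t)\colon V\to[0,1]$, $a_*(t)(v)=\sum_{i:\,a(i)=v}t_i$, is a homotopy equivalence, and it is natural in $K$ (with respect to simplicial maps of simplicial complexes).
   Context: A simplicial complex $(K,V)$ is a set $V$ together with a set $K$ of finite subsets of $V$ such that $\sigma\in K$ and $\tau\subseteq\sigma$ imply $\tau\in K$. A simplicial map $(K,V)\to(K',V')$ is a function $V\to V'$ sending every element of $K$ to an element of $K'$. The singular complex $\mathrm{Sing}(K)$ is the simplicial set with $\mathrm{Sing}(K)_m=\{a\colon\{0,1,\dots,m\}\to V\mid\{a(0),\dots,a(m)\}\in K\}$, with order-preserving maps $\{0,\dots,m'\}\to\{0,\dots,m\}$ acting by precomposition. $\Delta^m=\{(t_0,\dots,t_m)\in[0,1]^{m+1}\mid\sum t_i=1\}$, and $|\mathrm{Sing}(K)|$ is the usual geometric realization of a simplicial set, a quotient of $\coprod_m\mathrm{Sing}(K)_m\times\Delta^m$. For a finite set $S$, $[0,1]^S$ has the product topology. For an infinite set $S$, $[0,1]^S$ (all functions $S\to[0,1]$) has the topology in which $U$ is open if and only if $U\cap[0,1]^W$ is open in $[0,1]^W$ for every finite $W\subseteq S$, where $[0,1]^W$ is regarded as the set of functions $S\to[0,1]$ vanishing outside $W$. The geometric realization $|K|$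 is the subspace of $[0,1]^V$ consisting of the functions $\alpha\colon V\to[0,1]$ whose support $\{v:\alpha(v)\ne0\}$ is an element of $K$ and which satisfy $\sum_{v\in V}\alpha(v)=1$. A simplicial map given by $g\colon V\to V'$ induces $|\mathrm{Sing}(K)|\to|\mathrm{Sing}(K')|$ via $a\mapsto g\circ a$ and $|K|\to|K'|$ via $\alpha\mapsto\big(v'\mapsto\sum_{g(v)=v'}\alpha(v)\big)$. *)

theory Defs
  imports "HOL-Analysis.Analysis" "HOL-Homology.Simplices"
begin

section \<open>Abstract simplicial complexes\<close>

(* Named "abstract" because HOL-Analysis uses simplicial_complex for geometric complexes.
   Following the usual weak convention, K need not contain all singletons of V. *)
definition abstract_simplicial_complex :: "'a set set \<Rightarrow> 'a set \<Rightarrow> bool" where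
  "abstract_simplicial_complex K V \<longleftrightarrow>
     (\<forall>\<sigma>\<in>K. finite \<sigma> \<and> \<sigma> \<subseteq> V) \<and> (\<forall>\<sigma>\<in>K. \<forall>\<tau>. \<tau> \<subseteq> \<sigma> \<longrightarrow> \<tau> \<in> K)"

definition simplicial_map ::
    "'a set set \<Rightarrow> 'a set \<Rightarrow> 'b set set \<Rightarrow> 'b set \<Rightarrow> ('a \<Rightarrow> 'b) \<Rightarrow> bool" where
  "simplicial_map K V K' V' g \<longleftrightarrow> g \<in> V \<rightarrow> V' \<and> (\<forall>\<sigma>\<in>K. g ` \<sigma> \<in> K')"


section \<open>Simplicial sets\<close>

definition order_op :: "nat \<Rightarrow> nat \<Rightarrow> (nat \<Rightarrow> nat) set" where
  "order_op m' m = {\<theta> \<in> {..m'} \<rightarrow>\<^sub>E {..m}. mono_on {..m'} \<theta>}"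

(* For \<theta> \<in> order_op m' m, the map pull X m' m \<theta> goes from cells X m to cells X m'. *)
record 'x sset =
  cells :: "nat \<Rightarrow> 'x set"
  pull :: "nat \<Rightarrow> nat \<Rightarrow> (nat \<Rightarrow> nat) \<Rightarrow> 'x \<Rightarrow> 'x"

definition simplicial_set :: "'x sset \<Rightarrow> bool" where
  "simplicial_set X \<longleftrightarrow>
     (\<forall>m' m. \<forall>\<theta>\<in>order_op m' m. pull X m' m \<theta> \<in> cells X m \<rightarrow> cells X m') \<and>
     (\<forall>m. \<forall>x\<in>cells X m. pull X m m (\<lambda>i\<in>{..m}. i) x = x) \<and>
     (\<forall>m'' m' m. \<forall>\<eta>\<in>order_op m'' m'. \<forall>\<theta>\<in>order_op m' m. \<forall>x\<in>cells X m.
        pull X m'' m (compose {..m''} \<theta> \<eta>) x = pull X m'' m' \<eta> (pull X m' m \<theta> x))"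

definition simplicial_set_map :: "'x sset \<Rightarrow> 'y sset \<Rightarrow> (nat \<Rightarrow> 'x \<Rightarrow> 'y) \<Rightarrow> bool" where
  "simplicial_set_map X Y f \<longleftrightarrow>
     (\<forall>m. f m \<in> cells X m \<rightarrow> cells Y m) \<and>
     (\<forall>m' m. \<forall>\<theta>\<in>order_op m' m. \<forall>x\<in>cells X m. f m' (pull X m' m \<theta> x) = pull Y m' m \<theta> (f m x))"


section \<open>Geometric realization of a simplicial set\<close>

(* Used both for the maps between standard simplices induced by \<theta> \<in> order_op m' m
   and for a_*(t) with a an m-simplex of Sing(K). *)
definition pushforward :: "nat \<Rightarrow> (nat \<Rightarrow> 'a) \<Rightarrow> (nat \<Rightarrow> real) \<Rightarrow> 'a \<Rightarrow> real" where
  "pushforward m a t = (\<lambda>v. \<Sum>i | i \<le> m \<and> a i = v. t i)"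

definition simplex_sum :: "'x sset \<Rightarrow> (nat \<times> 'x \<times> (nat \<Rightarrow> real)) topology" where
  "simplex_sum X =
     sum_topology
       (\<lambda>m. prod_topology (discrete_topology (cells X m))
              (subtopology (powertop_real UNIV) (standard_simplex m)))
       UNIV"

inductive face_identification ::
    "'x sset \<Rightarrow> nat \<times> 'x \<times> (nat \<Rightarrow> real) \<Rightarrow> nat \<times> 'x \<times> (nat \<Rightarrow> real) \<Rightarrow> bool"
  for X where
    "\<lbrakk>\<theta> \<in> order_op m' m; x \<in> cells X m; t \<in> standard_simplex m'\<rbrakk> \<Longrightarrow>
       face_identification X (m', pull X m' m \<theta> x, t) (m, x, pushforward m' \<theta> t)"

definition realization_rel ::
    "'x sset \<Rightarrow> ((nat \<times> 'x \<times> (nat \<Rightarrow> real)) \<times> (nat \<times> 'x \<times> (nat \<Rightarrow> real))) set" where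
  "realization_rel X =
     {(p, q). p \<in> topspace (simplex_sum X) \<and> q \<in> topspace (simplex_sum X) \<and>
              equivclp (face_identification X) p q}"

definition realization_class ::
    "'x sset \<Rightarrow> nat \<times> 'x \<times> (nat \<Rightarrow> real) \<Rightarrow> (nat \<times> 'x \<times> (nat \<Rightarrow> real)) set" where
  "realization_class X p = realization_rel X `` {p}"

definition quotient_topology :: "'p topology \<Rightarrow> ('p \<Rightarrow> 'q) \<Rightarrow> 'q topology" where
  "quotient_topology T q =
     topology (\<lambda>U. U \<subseteq> q ` topspace T \<and> openin T {p \<in> topspace T. q p \<in> U})"

definition realization :: "'x sset \<Rightarrow> (nat \<times> 'x \<times> (nat \<Rightarrow> real)) set topology" where
  "realization X = quotient_topology (simplex_sum X) (realization_class X)"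

(* For a map f of simplicial sets, the image of a class lies in a single class,
   which is the value; see realization_map_class below. *)
definition realization_map ::
    "'y sset \<Rightarrow> (nat \<Rightarrow> 'x \<Rightarrow> 'y) \<Rightarrow> (nat \<times> 'x \<times> (nat \<Rightarrow> real)) set \<Rightarrow>
       (nat \<times> 'y \<times> (nat \<Rightarrow> real)) set" where
  "realization_map Y f c = realization_rel Y `` ((\<lambda>(m, x, t). (m, f m x, t)) ` c)"

lemma istopology_quotient:
  "istopology (\<lambda>U. U \<subseteq> q ` topspace T \<and> openin T {p \<in> topspace T. q p \<in> U})"
proof -
  have 1: "{p \<in> topspace T. q p \<in> A \<inter> B} =
      {p \<in> topspace T. q p \<in> A} \<inter> {p \<in> topspace T. q p \<in> B}" for A B
    by auto
  have 2: "{p \<in> topspace T. q p \<in> \<Union>\<K>} = (\<Union>A\<in>\<K>. {p \<in> topspace T. q p \<in> A})" for \<K>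
    by auto
  show ?thesis
    unfolding istopology_def
  proof (intro conjI allI impI)
    fix A B assume "A \<subseteq> q ` topspace T \<and> openin T {p \<in> topspace T. q p \<in> A}"
      and "B \<subseteq> q ` topspace T \<and> openin T {p \<in> topspace T. q p \<in> B}"
    then show "A \<inter> B \<subseteq> q ` topspace T" "openin T {p \<in> topspace T. q p \<in> A \<inter> B}"
      by (auto simp only: 1 intro: openin_Int)
  next
    fix \<K> assume \<K>: "\<forall>A\<in>\<K>. A \<subseteq> q ` topspace T \<and> openin T {p \<in> topspace T. q p \<in> A}"
    then show "\<Union>\<K> \<subseteq> q ` topspace T" by blast
    show "openin T {p \<in> topspace T. q p \<in> \<Union>\<K>}"
      unfolding 2 by (rule openin_Union) (use \<K> in blast)
  qed
qed

lemma openin_quotient_topology: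
  "openin (quotient_topology T q) U \<longleftrightarrow>
     U \<subseteq> q ` topspace T \<and> openin T {p \<in> topspace T. q p \<in> U}"
  by (simp add: quotient_topology_def istopology_quotient)

lemma topspace_quotient_topology [simp]: "topspace (quotient_topology T q) = q ` topspace T"
proof (rule antisym)
  show "topspace (quotient_topology T q) \<subseteq> q ` topspace T"
    using openin_quotient_topology [of T q "topspace (quotient_topology T q)"] by simp
  have "{p \<in> topspace T. q p \<in> q ` topspace T} = topspace T" by auto
  then have "openin (quotient_topology T q) (q ` topspace T)"
    by (simp add: openin_quotient_topology)
  then show "q ` topspace T \<subseteq> topspace (quotient_topology T q)"
    by (rule openin_subset)
qed

lemma quotient_map_quotient_topology: "quotient_map T (quotient_topology T q) q"
  by (simp add: quotient_map_def openin_quotient_topology)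

lemma topspace_simplex_sum:
  "(m, x, t) \<in> topspace (simplex_sum X) \<longleftrightarrow> x \<in> cells X m \<and> t \<in> standard_simplex m"
  by (simp add: simplex_sum_def)

lemma equiv_realization_rel: "equiv (topspace (simplex_sum X)) (realization_rel X)"
  unfolding realization_rel_def
  by (intro equivI refl_onI symI transI) (auto intro: equivclp_sym equivclp_trans)

lemma face_identification_map:
  assumes "simplicial_set_map X Y f" "face_identification X p q"
  shows "face_identification Y ((\<lambda>(m, x, t). (m, f m x, t)) p) ((\<lambda>(m, x, t). (m, f m x, t)) q)"
  using assms(2)
proof cases
  case (1 \<theta> m' m x t)
  then have "f m' (pull X m' m \<theta> x) = pull Y m' m \<theta> (f m x)" "f m x \<in> cells Y m"
    using assms(1) by (auto simp: simplicial_set_map_def)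
  with 1 show ?thesis by (simp add: face_identification.intros)
qed

lemma realization_map_class:
  assumes f: "simplicial_set_map X Y f" and x: "x \<in> cells X m" and t: "t \<in> standard_simplex m"
  shows "realization_map Y f (realization_class X (m, x, t)) = realization_class Y (m, f m x, t)"
proof -
  let ?F = "\<lambda>(m, x, t). (m, f m x, t)"
  have cl: "equivclp (face_identification Y) (?F p) (?F q)"
    if "equivclp (face_identification X) p q" for p q
    using that
  proof (induction rule: equivclp_induct)
    case base
    then show ?case by simp
  next
    case (step y z)
    then have "face_identification Y (?F y) (?F z) \<or> face_identification Y (?F z) (?F y)"
      using face_identification_map [OF f] by blast
    then have "equivclp (face_identification Y) (?F y) (?F z)"
      by (meson equivclp_sym r_into_equivclp)
    with step.IH show ?case by (rule equivclp_trans)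
  qed
  have top: "?F p \<in> topspace (simplex_sum Y)" if "p \<in> topspace (simplex_sum X)" for p
    using that f by (cases p) (auto simp: topspace_simplex_sum simplicial_set_map_def)
  have rel: "(?F p, ?F q) \<in> realization_rel Y" if "(p, q) \<in> realization_rel X" for p q
    using that cl [of p q] top [of p] top [of q] by (simp add: realization_rel_def)
  have "(m, x, t) \<in> topspace (simplex_sum X)"
    using x t by (simp add: topspace_simplex_sum)
  then have self: "(m, x, t) \<in> realization_class X (m, x, t)"
    unfolding realization_class_def by (rule equiv_class_self [OF equiv_realization_rel])
  have eq: "realization_rel Y `` {?F p} = realization_rel Y `` {?F (m, x, t)}"
    if "p \<in> realization_class X (m, x, t)" for p
  proof -
    from that have "((m, x, t), p) \<in> realization_rel X"
      by (simp only: realization_class_def Image_singleton_iff)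
    from equiv_class_eq [OF equiv_realization_rel rel [OF this]] show ?thesis ..
  qed
  have "realization_map Y f (realization_class X (m, x, t)) =
      (\<Union>p\<in>realization_class X (m, x, t). realization_rel Y `` {?F p})"
    unfolding realization_map_def by blast
  also have "\<dots> = realization_rel Y `` {?F (m, x, t)}"
    using eq self by blast
  finally show ?thesis by (simp add: realization_class_def)
qed


section \<open>The singular complex\<close>

(* A map {0..m} -> V is an extensional function, so that each simplex has one representative. *)
definition Sing :: "'a set set \<Rightarrow> 'a set \<Rightarrow> (nat \<Rightarrow> 'a) sset" where
  "Sing K V =
     \<lparr>cells = (\<lambda>m. {a \<in> {..m} \<rightarrow>\<^sub>E V. a ` {..m} \<in> K}),
      pull = (\<lambda>m' m \<theta> a. compose {..m'} a \<theta>)\<rparr>"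

definition Sing_map :: "('a \<Rightarrow> 'b) \<Rightarrow> nat \<Rightarrow> (nat \<Rightarrow> 'a) \<Rightarrow> (nat \<Rightarrow> 'b)" where
  "Sing_map g m a = compose {..m} g a"

lemma simplicial_set_Sing:
  assumes "abstract_simplicial_complex K V"
  shows "simplicial_set (Sing K V)"
  unfolding simplicial_set_def
proof (intro conjI allI ballI)
  fix m' m \<theta> assume \<theta>: "\<theta> \<in> order_op m' m"
  show "pull (Sing K V) m' m \<theta> \<in> cells (Sing K V) m \<rightarrow> cells (Sing K V) m'"
  proof
    fix a assume a: "a \<in> cells (Sing K V) m"
    have "compose {..m'} a \<theta> ` {..m'} \<subseteq> a ` {..m}"
      using \<theta> by (auto simp: compose_def order_op_def)
    then have "compose {..m'} a \<theta> ` {..m'} \<in> K"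
      using a assms unfolding Sing_def abstract_simplicial_complex_def by fastforce
    then show "pull (Sing K V) m' m \<theta> a \<in> cells (Sing K V) m'"
      using a \<theta> by (auto simp: Sing_def compose_def order_op_def PiE_iff)
  qed
next
  fix m a assume "a \<in> cells (Sing K V) m"
  then show "pull (Sing K V) m m (\<lambda>i\<in>{..m}. i) a = a"
    by (auto simp: Sing_def compose_def fun_eq_iff PiE_def extensional_def)
next
  fix m'' m' m \<eta> \<theta> a
  assume "\<eta> \<in> order_op m'' m'"
  then show "pull (Sing K V) m'' m (compose {..m''} \<theta> \<eta>) a =
      pull (Sing K V) m'' m' \<eta> (pull (Sing K V) m' m \<theta> a)"
    by (auto simp: Sing_def compose_def fun_eq_iff order_op_def PiE_iff)
qed

lemma simplicial_set_map_Sing: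
  assumes "simplicial_map K V K' V' g"
  shows "simplicial_set_map (Sing K V) (Sing K' V') (Sing_map g)"
  unfolding simplicial_set_map_def
proof (intro conjI allI ballI)
  fix m
  show "Sing_map g m \<in> cells (Sing K V) m \<rightarrow> cells (Sing K' V') m"
  proof
    fix a assume a: "a \<in> cells (Sing K V) m"
    have "Sing_map g m a ` {..m} = g ` a ` {..m}"
      by (auto simp: Sing_map_def compose_def)
    then show "Sing_map g m a \<in> cells (Sing K' V') m"
      using a assms
      by (auto simp: Sing_def simplicial_map_def Sing_map_def compose_def PiE_iff)
  qed
next
  fix m' m \<theta> a assume "\<theta> \<in> order_op m' m"
  then show "Sing_map g m' (pull (Sing K V) m' m \<theta> a) = pull (Sing K' V') m' m \<theta> (Sing_map g m a)"
    by (auto simp: Sing_def Sing_map_def compose_def fun_eq_iff order_op_def PiE_iff)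
qed


section \<open>Geometric realization of a simplicial complex\<close>

(* A function S -> [0,1] is represented by its extension by zero, so that cube W is a subset of
   cube S for W \<subseteq> S. *)
definition cube :: "'a set \<Rightarrow> ('a \<Rightarrow> real) set" where
  "cube S = {\<alpha>. (\<forall>v. 0 \<le> \<alpha> v \<and> \<alpha> v \<le> 1) \<and> (\<forall>v. v \<notin> S \<longrightarrow> \<alpha> v = 0)}"

(* The product topology on [0,1]^S; see homeomorphic_map_product_cube. *)
definition product_cube :: "'a set \<Rightarrow> ('a \<Rightarrow> real) topology" where
  "product_cube S = subtopology (powertop_real UNIV) (cube S)"

definition cube_topology :: "'a set \<Rightarrow> ('a \<Rightarrow> real) topology" where
  "cube_topology S =
     (if finite S then product_cube S
      else topology (\<lambda>U. U \<subseteq> cube S \<and>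
             (\<forall>W. finite W \<and> W \<subseteq> S \<longrightarrow> openin (product_cube W) (U \<inter> cube W))))"

definition complex_realization :: "'a set set \<Rightarrow> 'a set \<Rightarrow> ('a \<Rightarrow> real) topology" where
  "complex_realization K V =
     subtopology (cube_topology V)
       {\<alpha> \<in> cube V. {v. \<alpha> v \<noteq> 0} \<in> K \<and> (\<Sum>v | \<alpha> v \<noteq> 0. \<alpha> v) = 1}"

(* The sum over the fibre g(v) = v' is restricted to the (finite) support of \<alpha>, since sum
   over an infinite set is 0 by convention. *)
definition complex_realization_map ::
    "'a set \<Rightarrow> ('a \<Rightarrow> 'b) \<Rightarrow> ('a \<Rightarrow> real) \<Rightarrow> 'b \<Rightarrow> real" where
  "complex_realization_map V g \<alpha> = (\<lambda>v'. \<Sum>v | v \<in> V \<and> \<alpha> v \<noteq> 0 \<and> g v = v'. \<alpha> v)"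

lemma topspace_product_cube [simp]: "topspace (product_cube S) = cube S"
  by (simp add: product_cube_def)

lemma homeomorphic_map_product_cube:
  "homeomorphic_map (product_cube S) (product_topology (\<lambda>_. top_of_set {0..1}) S)
     (\<lambda>\<alpha>. restrict \<alpha> S)"
proof -
  let ?g = "\<lambda>\<beta> v. if v \<in> S then \<beta> v else (0::real)"
  have c1: "continuous_map (product_cube S) (product_topology (\<lambda>_. top_of_set {0..1}) S)
      (\<lambda>\<alpha>. restrict \<alpha> S)"
    unfolding continuous_map_componentwise
  proof (intro conjI ballI)
    fix k assume k: "k \<in> S"
    have "continuous_map (powertop_real UNIV) euclideanreal (\<lambda>x. x k)"
      by (rule continuous_map_product_projection) simp
    then have "continuous_map (product_cube S) euclideanreal (\<lambda>x. x k)"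
      unfolding product_cube_def by (rule continuous_map_from_subtopology)
    then show "continuous_map (product_cube S) (top_of_set {0..1}) (\<lambda>x. restrict x S k)"
      using k by (auto simp: continuous_map_in_subtopology cube_def)
  qed auto
  have "continuous_map (product_topology (\<lambda>_. top_of_set {0..1}) S) euclideanreal (\<lambda>x. ?g x k)" for k
  proof (cases "k \<in> S")
    case True
    then have "continuous_map (product_topology (\<lambda>_. top_of_set {0..1::real}) S)
        (top_of_set {0..1}) (\<lambda>x. x k)"
      by (rule continuous_map_product_projection)
    with True show ?thesis by (simp add: continuous_map_in_subtopology)
  qed simp
  then have c2: "continuous_map (product_topology (\<lambda>_. top_of_set {0..1}) S) (product_cube S) ?g"
    unfolding product_cube_def continuous_map_in_subtopology continuous_map_componentwise_UNIV
    by (auto simp: cube_def PiE_iff)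
  have "homeomorphic_maps (product_cube S) (product_topology (\<lambda>_. top_of_set {0..1}) S)
      (\<lambda>\<alpha>. restrict \<alpha> S) ?g"
    unfolding homeomorphic_maps_def
  proof (intro conjI ballI c1 c2)
    fix \<alpha> assume "\<alpha> \<in> topspace (product_cube S)"
    then show "?g (restrict \<alpha> S) = \<alpha>" by (auto simp: cube_def)
  next
    fix \<beta> assume "\<beta> \<in> topspace (product_topology (\<lambda>_. top_of_set {0..1::real}) S)"
    then show "restrict (?g \<beta>) S = \<beta>"
      by (auto simp: fun_eq_iff PiE_def extensional_def)
  qed
  then show ?thesis
    using homeomorphic_maps_map by blast
qed

lemma istopology_cube:
  "istopology (\<lambda>U. U \<subseteq> cube S \<and>
     (\<forall>W. finite W \<and> W \<subseteq> S \<longrightarrow> openin (product_cube W) (U \<inter> cube W)))"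
proof -
  have union: "\<Union>\<K> \<inter> cube W = (\<Union>A\<in>\<K>. A \<inter> cube W)" for \<K> and W :: "'a set"
    by auto
  show ?thesis
    unfolding istopology_def
  proof (intro conjI allI impI)
    fix A B
    assume A: "A \<subseteq> cube S \<and>
        (\<forall>W. finite W \<and> W \<subseteq> S \<longrightarrow> openin (product_cube W) (A \<inter> cube W))"
      and B: "B \<subseteq> cube S \<and>
        (\<forall>W. finite W \<and> W \<subseteq> S \<longrightarrow> openin (product_cube W) (B \<inter> cube W))"
    then show "A \<inter> B \<subseteq> cube S" by blast
    fix W assume W: "finite W \<and> W \<subseteq> S"
    have "openin (product_cube W) ((A \<inter> cube W) \<inter> (B \<inter> cube W))"
      using A B W by (blast intro: openin_Int)
    moreover have "(A \<inter> cube W) \<inter> (B \<inter> cube W) = A \<inter> B \<inter> cube W" by blast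
    ultimately show "openin (product_cube W) (A \<inter> B \<inter> cube W)" by (rule back_subst)
  next
    fix \<K> assume \<K>: "\<forall>A\<in>\<K>. A \<subseteq> cube S \<and>
        (\<forall>W. finite W \<and> W \<subseteq> S \<longrightarrow> openin (product_cube W) (A \<inter> cube W))"
    then show "\<Union>\<K> \<subseteq> cube S" by blast
    fix W assume "finite W \<and> W \<subseteq> S"
    then show "openin (product_cube W) (\<Union>\<K> \<inter> cube W)"
      unfolding union by (intro openin_Union) (use \<K> in blast)
  qed
qed

lemma openin_cube_topology_infinite:
  assumes "infinite S"
  shows "openin (cube_topology S) U \<longleftrightarrow>
     U \<subseteq> cube S \<and> (\<forall>W. finite W \<and> W \<subseteq> S \<longrightarrow> openin (product_cube W) (U \<inter> cube W))"
  using assms by (simp add: cube_topology_def istopology_cube)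


section \<open>The comparison map and homotopy equivalences\<close>

(* The common value of a_*(t) over all representatives (m, a, t) of the class c. *)
definition sing_comparison ::
    "(nat \<times> (nat \<Rightarrow> 'a) \<times> (nat \<Rightarrow> real)) set \<Rightarrow> 'a \<Rightarrow> real" where
  "sing_comparison c = the_elem ((\<lambda>(m, a, t). pushforward m a t) ` c)"

definition homotopy_equivalence_map :: "'p topology \<Rightarrow> 'q topology \<Rightarrow> ('p \<Rightarrow> 'q) \<Rightarrow> bool" where
  "homotopy_equivalence_map X Y f \<longleftrightarrow>
     continuous_map X Y f \<and>
     (\<exists>g. continuous_map Y X g \<and>
          homotopic_with (\<lambda>_. True) X X (g \<circ> f) id \<and>
          homotopic_with (\<lambda>_. True) Y Y (f \<circ> g) id)"

end

theory Submission
  imports Defs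
begin

text \<open>
  Fix a total order on the vertices. Listing the support of a point of \<open>|K|\<close> in increasing order
  gives a section of the comparison map. It is continuous because \<open>|K|\<close> is closed in the cube,
  hence carries the weak topology with respect to its closed simplices. To deform the identity of
  \<open>|Sing K|\<close> to the section after the comparison map, append to a singular simplex \<open>a\<close> the
  increasing list of its vertices: the result is still a simplex of \<open>Sing K\<close>, and moving the weights
  linearly from the first block to the second respects the face identifications. The homotopy descends
  since the product of a quotient map with the locally compact space \<open>[0,1]\<close> is a quotient map.
\<close>

section \<open>Points of the realization of a simplicial set\<close>

text \<open>The vertices of a simplex of \<open>Sing K V\<close> come in arbitrary order and with
  repetitions, and order-preserving maps cannot permute them, so a class in general differs from
  that of its sorted version. The longer list is the bridge: both versions are faces of one simplex
  that uses no new vertex. The appended list contains all vertices of \<open>a\<close>, also those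
  of total weight zero, instead of the support of the image point. It then depends on the cell
  alone, so continuity in the weights can be read off; the price is that a point must give the same
  class whichever simplex around its support is enumerated. One order on the whole vertex type
  ensures this: the enumeration of a face is the pullback of the enumeration of the simplex along an
  order-preserving map. The comparison map after the section is exactly the identity, so only one
  genuine homotopy has to be built. The section depends on the chosen order and commutes in general
  not with simplicial maps; naturality is a statement about the comparison map alone.\<close>

lemma pushforward_nonneg: "t \<in> standard_simplex m \<Longrightarrow> 0 \<le> pushforward m a t v"
  unfolding pushforward_def standard_simplex_def by (auto intro!: sum_nonneg)

lemma pushforward_eq_0: "v \<notin> a ` {..m} \<Longrightarrow> pushforward m a t v = 0"
  unfolding pushforward_def by (rule sum.neutral) auto

lemma sum_pushforward:
  assumes "finite S" "a ` {..m} \<subseteq> S" shows "(\<Sum>v\<in>S. pushforward m a t v) = sum t {..m}"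
  using sum.group[of "{..m}" S a t] assms by (simp add: pushforward_def)

lemma pushforward_in_standard_simplex:
  assumes t: "t \<in> standard_simplex m'" and \<theta>: "\<theta> ` {..m'} \<subseteq> {..m}"
  shows "pushforward m' \<theta> t \<in> standard_simplex m"
proof -
  have s: "(\<Sum>i\<le>m. pushforward m' \<theta> t i) = 1"
    using sum_pushforward[OF _ \<theta>, of t] t by (simp add: standard_simplex_def)
  have z: "pushforward m' \<theta> t i = 0" if "i > m" for i
    by (rule pushforward_eq_0) (use that \<theta> in force)
  have "pushforward m' \<theta> t i \<le> 1" for i
  proof (cases "i \<le> m")
    case True
    then have "pushforward m' \<theta> t i \<le> (\<Sum>i\<le>m. pushforward m' \<theta> t i)"
      by (intro member_le_sum) (auto intro: pushforward_nonneg[OF t])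
    with s show ?thesis by simp
  qed (use z in auto)
  with s z pushforward_nonneg[OF t] show ?thesis by (auto simp: standard_simplex_def)
qed

text \<open>The fibre of the composite over \<open>v\<close> splits according to the value of
  \<theta>. This functoriality is what makes the comparison map independent of the
  representative.\<close>

lemma pushforward_compose:
  assumes "\<theta> ` {..m'} \<subseteq> {..m}"
  shows "pushforward m' (compose {..m'} a \<theta>) t = pushforward m a (pushforward m' \<theta> t)"
proof
  fix v
  let ?S = "{i. i \<le> m' \<and> a (\<theta> i) = v}" and ?T = "{j. j \<le> m \<and> a j = v}"
  have "{i. i \<le> m' \<and> compose {..m'} a \<theta> i = v} = ?S" by (auto simp: compose_def)
  then have "pushforward m' (compose {..m'} a \<theta>) t v = sum t ?S"
    by (simp add: pushforward_def)
  also have "\<dots> = (\<Sum>j\<in>?T. sum t {i \<in> ?S. \<theta> i = j})"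
    by (rule sum.group[symmetric]) (use assms in auto)
  also have "\<dots> = pushforward m a (pushforward m' \<theta> t) v"
    unfolding pushforward_def by (intro sum.cong refl) auto
  finally show "pushforward m' (compose {..m'} a \<theta>) t v = pushforward m a (pushforward m' \<theta> t) v" .
qed

lemma pushforward_inj:
  assumes "inj_on a {..m}" "j \<le> m" shows "pushforward m a t (a j) = t j"
proof -
  have "{i. i \<le> m \<and> a i = a j} = {j}" using assms by (auto simp: inj_on_def)
  then show ?thesis by (simp add: pushforward_def)
qed

lemma order_op_image: "\<theta> \<in> order_op m' m \<Longrightarrow> \<theta> ` {..m'} \<subseteq> {..m}"
  by (auto simp: order_op_def)

lemma realization_class_pull:
  assumes X: "simplicial_set X" and \<theta>: "\<theta> \<in> order_op m' m" and x: "x \<in> cells X m"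
    and t: "t \<in> standard_simplex m'"
  shows "realization_class X (m', pull X m' m \<theta> x, t) = realization_class X (m, x, pushforward m' \<theta> t)"
  unfolding realization_class_def
proof (rule equiv_class_eq [OF equiv_realization_rel])
  have "pull X m' m \<theta> x \<in> cells X m'"
    using X \<theta> x by (auto simp: simplicial_set_def)
  with pushforward_in_standard_simplex[OF t order_op_image[OF \<theta>]] x t
    face_identification.intros[OF \<theta> x t]
  show "((m', pull X m' m \<theta> x, t), (m, x, pushforward m' \<theta> t)) \<in> realization_rel X"
    by (auto simp: realization_rel_def topspace_simplex_sum)
qed

lemma face_identification_invariant:
  assumes "equivclp (face_identification X) p q"
    and "\<And>p q. face_identification X p q \<Longrightarrow> f p = f q"
  shows "f p = f q"
  using assms(1) by (induction rule: equivclp_induct) (use assms(2) in metis)+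

lemma realization_class_eqD:
  assumes "realization_class X p = realization_class X q" "p \<in> topspace (simplex_sum X)"
    "q \<in> topspace (simplex_sum X)"
  shows "equivclp (face_identification X) p q"
  using eq_equiv_class_iff[OF equiv_realization_rel, of p X q] assms
  by (simp add: realization_class_def realization_rel_def)

section \<open>Continuity into and out of a disjoint union of simplices\<close>

lemma continuous_map_realization_class:
  assumes "x \<in> cells X m" "continuous_map T (powertop_real UNIV) u"
    "\<And>z. z \<in> topspace T \<Longrightarrow> u z \<in> standard_simplex m"
  shows "continuous_map T (realization X) (\<lambda>z. realization_class X (m, x, u z))"
proof -
  let ?Y = "\<lambda>m. prod_topology (discrete_topology (cells X m))
              (subtopology (powertop_real UNIV) (standard_simplex m))"
  have "continuous_map T (?Y m) (\<lambda>z. (x, u z))"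
    using assms by (intro continuous_map_pairedI) (auto simp: continuous_map_in_subtopology)
  then have "continuous_map T (simplex_sum X) ((\<lambda>p. (m, p)) \<circ> (\<lambda>z. (x, u z)))"
    unfolding simplex_sum_def
    by (rule continuous_map_compose) (rule continuous_map_component_injection[of m UNIV ?Y], simp)
  moreover have "continuous_map (simplex_sum X) (realization X) (realization_class X)"
    unfolding realization_def by (simp add: quotient_map_quotient_topology quotient_imp_continuous_map)
  ultimately have "continuous_map T (realization X)
      (realization_class X \<circ> ((\<lambda>p. (m, p)) \<circ> (\<lambda>z. (x, u z))))"
    by (rule continuous_map_compose)
  then show ?thesis by (simp add: o_def)
qed

text \<open>Points of every \<open>standard_simplex m\<close> are extended by zero to functions on
  all naturals, so the weights of all summands live in one space and a single projection serves the
  whole union.\<close>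

lemma continuous_map_simplex_sum_weights:
  "continuous_map (simplex_sum X) (powertop_real UNIV) (\<lambda>p. snd (snd p))"
  unfolding continuous_map_def
proof (intro conjI allI impI)
  fix U :: "(nat \<Rightarrow> real) set" assume U: "openin (powertop_real UNIV) U"
  have "openin (prod_topology (discrete_topology (cells X m))
      (subtopology (powertop_real UNIV) (standard_simplex m)))
      {x. (m, x) \<in> {p \<in> topspace (simplex_sum X). snd (snd p) \<in> U}}" for m
  proof -
    have "{x. (m, x) \<in> {p \<in> topspace (simplex_sum X). snd (snd p) \<in> U}} =
        cells X m \<times> (standard_simplex m \<inter> U)"
      by (auto simp: topspace_simplex_sum)
    then show ?thesis using U by (auto simp: openin_prod_Times_iff openin_subtopology_Int2)
  qed
  then show "openin (simplex_sum X) {p \<in> topspace (simplex_sum X). snd (snd p) \<in> U}"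
    unfolding simplex_sum_def openin_sum_topology by (auto simp: simplex_sum_def)
qed auto

lemma openin_simplex_sum_piece:
  assumes "x \<in> cells X m"
  shows "openin (simplex_sum X) ({m} \<times> {x} \<times> standard_simplex m)"
proof -
  have "{y. (m', y) \<in> {m} \<times> {x} \<times> standard_simplex m} =
      (if m' = m then {x} \<times> standard_simplex m else {})" for m'
    by auto
  with assms show ?thesis
    unfolding simplex_sum_def openin_sum_topology
    by (auto simp: openin_prod_Times_iff openin_subtopology_refl)
qed

text \<open>The cells are discrete, so the preimages of the single simplices form an open cover and
  continuity can be checked with the cell held fixed. The map \<pi> is left general in order to
  treat the union itself (\<open>id\<close>) and its product with an interval
  (\<open>snd\<close>).\<close>

lemma continuous_map_simplex_sum_pieces:
  assumes \<pi>: "continuous_map T (simplex_sum X) \<pi>"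
    and f: "\<And>m x. x \<in> cells X m \<Longrightarrow>
      continuous_map (subtopology T {z \<in> topspace T. \<pi> z \<in> {m} \<times> {x} \<times> standard_simplex m}) Y f"
  shows "continuous_map T Y f"
proof (rule pasting_lemma[where I = "{(m, x). x \<in> cells X m}" and f = "\<lambda>_. f"
      and T = "\<lambda>(m, x). {z \<in> topspace T. \<pi> z \<in> {m} \<times> {x} \<times> standard_simplex m}"])
  fix i assume "i \<in> {(m, x). x \<in> cells X m}"
  then show "openin T (case i of (m, x) \<Rightarrow> {z \<in> topspace T. \<pi> z \<in> {m} \<times> {x} \<times> standard_simplex m})"
    using openin_continuous_map_preimage[OF \<pi> openin_simplex_sum_piece] by auto
next
  fix i assume "i \<in> {(m, x). x \<in> cells X m}"
  then show "continuous_map (subtopology T (case i of (m, x) \<Rightarrow>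
      {z \<in> topspace T. \<pi> z \<in> {m} \<times> {x} \<times> standard_simplex m})) Y f"
    using f by auto
next
  fix z assume z: "z \<in> topspace T"
  obtain m x t where p: "\<pi> z = (m, x, t)" by (cases "\<pi> z")
  have "\<pi> z \<in> topspace (simplex_sum X)" using z \<pi> by (auto simp: continuous_map_def)
  with p z show "\<exists>j. j \<in> {(m, x). x \<in> cells X m} \<and>
      z \<in> (case j of (m, x) \<Rightarrow> {z \<in> topspace T. \<pi> z \<in> {m} \<times> {x} \<times> standard_simplex m}) \<and> f z = f z"
    by (intro exI[of _ "(m, x)"]) (auto simp: topspace_simplex_sum)
qed auto

section \<open>Order enumerations of finite sets\<close>

text \<open>The well-ordering theorem supplies a linear order on an arbitrary vertex type. A single
  global choice keeps the enumerations of different simplices compatible.\<close>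

definition vertex_order :: "'a rel" where
  "vertex_order = (SOME r. Well_order r \<and> Field r = UNIV)"

definition vertex_rank :: "'a set \<Rightarrow> 'a \<Rightarrow> nat" where
  "vertex_rank \<sigma> v = card {w \<in> \<sigma>. w \<noteq> v \<and> (w, v) \<in> vertex_order}"

text \<open>Extensional on \<open>{..card \<sigma> - 1}\<close> because the simplices of
  \<open>Sing\<close> are. For empty \<sigma> the truncated subtraction leaves the position 0,
  whence the nonemptiness assumptions below.\<close>

definition enum :: "'a set \<Rightarrow> nat \<Rightarrow> 'a" where
  "enum \<sigma> = (\<lambda>i\<in>{..card \<sigma> - 1}. the_inv_into \<sigma> (vertex_rank \<sigma>) i)"

lemma vertex_order: "Well_order (vertex_order :: 'a rel)" "Field (vertex_order :: 'a rel) = UNIV"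
  using someI_ex[OF well_ordering[where 'a = 'a]] by (auto simp: vertex_order_def)

lemma vertex_order_trans: "(u, v) \<in> vertex_order \<Longrightarrow> (v, w) \<in> vertex_order \<Longrightarrow> (u, w) \<in> vertex_order"
  using vertex_order by (auto simp: order_on_defs dest: transD)

lemma vertex_order_antisym: "(u, v) \<in> vertex_order \<Longrightarrow> (v, u) \<in> vertex_order \<Longrightarrow> u = v"
  using vertex_order by (auto simp: order_on_defs dest: antisymD)

lemma vertex_order_total: "(u :: 'a, v) \<in> vertex_order \<or> (v, u) \<in> vertex_order"
proof -
  have "total (vertex_order :: 'a rel)" "refl (vertex_order :: 'a rel)"
    using vertex_order[where 'a = 'a] by (simp_all add: order_on_defs)
  then show ?thesis by (metis UNIV_I refl_on_def total_on_def)
qed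

lemma rank_less:
  assumes "finite \<sigma>" "u \<in> \<sigma>" "u \<noteq> v" "(u, v) \<in> vertex_order"
  shows "vertex_rank \<sigma> u < vertex_rank \<sigma> v"
  unfolding vertex_rank_def
proof (rule psubset_card_mono)
  show "{w \<in> \<sigma>. w \<noteq> u \<and> (w, u) \<in> vertex_order} \<subset> {w \<in> \<sigma>. w \<noteq> v \<and> (w, v) \<in> vertex_order}"
    using assms by (auto intro: vertex_order_trans dest: vertex_order_antisym)
qed (use assms in auto)

lemma rank_le_iff:
  assumes "finite \<sigma>" "u \<in> \<sigma>" "v \<in> \<sigma>"
  shows "vertex_rank \<sigma> u \<le> vertex_rank \<sigma> v \<longleftrightarrow> (u, v) \<in> vertex_order"
  using rank_less[of \<sigma> u v] rank_less[of \<sigma> v u] assms vertex_order_total[of u v]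
  by (metis leD less_imp_le_nat order_refl vertex_order_antisym)

text \<open>The rank is strictly increasing, hence injective, and never counts the vertex itself,
  hence is at most \<open>card \<sigma> - 1\<close>; comparing cardinalities gives
  surjectivity.\<close>

lemma bij_betw_rank:
  assumes "finite \<sigma>" "\<sigma> \<noteq> {}" shows "bij_betw (vertex_rank \<sigma>) \<sigma> {..card \<sigma> - 1}"
proof -
  have inj: "inj_on (vertex_rank \<sigma>) \<sigma>"
    by (rule inj_onI) (metis assms(1) order_refl rank_le_iff vertex_order_antisym)
  have "vertex_rank \<sigma> v \<le> card \<sigma> - 1" if "v \<in> \<sigma>" for v
  proof -
    have "vertex_rank \<sigma> v \<le> card (\<sigma> - {v})"
      unfolding vertex_rank_def using assms by (intro card_mono) auto
    with that assms show ?thesis by simp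
  qed
  then have "vertex_rank \<sigma> ` \<sigma> = {..card \<sigma> - 1}"
    using assms card_gt_0_iff[of \<sigma>] by (intro card_subset_eq) (auto simp: card_image[OF inj])
  with inj show ?thesis by (simp add: bij_betw_def)
qed

lemma bij_betw_enum:
  assumes "finite \<sigma>" "\<sigma> \<noteq> {}" shows "bij_betw (enum \<sigma>) {..card \<sigma> - 1} \<sigma>"
  using bij_betw_the_inv_into[OF bij_betw_rank[OF assms]]
  by (simp add: enum_def bij_betw_restrict_eq)

lemma rank_enum:
  assumes "finite \<sigma>" "\<sigma> \<noteq> {}" "i \<le> card \<sigma> - 1" shows "vertex_rank \<sigma> (enum \<sigma> i) = i"
  using f_the_inv_into_f_bij_betw[OF bij_betw_rank[OF assms(1,2)]] assms(3) by (simp add: enum_def)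

lemma enum_rank:
  assumes "finite \<sigma>" "v \<in> \<sigma>" shows "enum \<sigma> (vertex_rank \<sigma> v) = v"
proof -
  have b: "bij_betw (vertex_rank \<sigma>) \<sigma> {..card \<sigma> - 1}" using bij_betw_rank[of \<sigma>] assms by blast
  then have "vertex_rank \<sigma> v \<in> {..card \<sigma> - 1}" "the_inv_into \<sigma> (vertex_rank \<sigma>) (vertex_rank \<sigma> v) = v"
    using assms by (auto simp: bij_betw_def the_inv_into_f_f)
  then show ?thesis by (simp add: enum_def)
qed

text \<open>Ranks in \<tau> and in \<sigma> reflect the same vertex order, so sending a position in
  \<tau> to the rank of its vertex in \<sigma> is monotone. All agreements between different
  enumerations rest on this \<iota>.\<close>

lemma enum_face:
  assumes \<sigma>: "finite \<sigma>" and \<tau>: "\<tau> \<subseteq> \<sigma>" "\<tau> \<noteq> {}"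
  obtains \<iota> where "\<iota> \<in> order_op (card \<tau> - 1) (card \<sigma> - 1)"
    "enum \<tau> = compose {..card \<tau> - 1} (enum \<sigma>) \<iota>"
proof
  let ?\<iota> = "\<lambda>i\<in>{..card \<tau> - 1}. vertex_rank \<sigma> (enum \<tau> i)"
  have f: "finite \<tau>" using \<sigma> \<tau> finite_subset by blast
  have e: "enum \<tau> i \<in> \<tau>" "enum \<tau> i \<in> \<sigma>" if "i \<le> card \<tau> - 1" for i
    using bij_betwE[OF bij_betw_enum[OF f \<tau>(2)]] that \<tau> by auto
  have r: "vertex_rank \<sigma> (enum \<tau> i) \<in> {..card \<sigma> - 1}" if "i \<le> card \<tau> - 1" for i
    using bij_betwE[OF bij_betw_rank[of \<sigma>]] e(2)[OF that] \<sigma> by blast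
  show "?\<iota> \<in> order_op (card \<tau> - 1) (card \<sigma> - 1)"
    unfolding order_op_def
  proof (intro CollectI conjI mono_onI)
    fix i j assume "i \<in> {..card \<tau> - 1}" "j \<in> {..card \<tau> - 1}" "i \<le> j"
    moreover from this have "vertex_rank \<tau> (enum \<tau> i) \<le> vertex_rank \<tau> (enum \<tau> j)"
      using f \<tau> by (simp add: rank_enum)
    ultimately show "?\<iota> i \<le> ?\<iota> j" using e f \<sigma> by (simp add: rank_le_iff)
  qed (use r in auto)
  show "enum \<tau> = compose {..card \<tau> - 1} (enum \<sigma>) ?\<iota>"
  proof
    fix i show "enum \<tau> i = compose {..card \<tau> - 1} (enum \<sigma>) ?\<iota> i"
      using enum_rank[OF \<sigma> e(2), of i] by (auto simp: compose_def) (simp add: enum_def)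
  qed
qed

section \<open>Closed cells of a simplicial complex\<close>

text \<open>The geometric simplex spanned by \<sigma> together with its boundary: the support may be
  smaller than \<sigma>. This makes it closed under pointwise limits for finite \<sigma>.\<close>

definition closed_cell :: "'a set \<Rightarrow> ('a \<Rightarrow> real) set" where
  "closed_cell \<sigma> = {\<alpha>. (\<forall>v. 0 \<le> \<alpha> v) \<and> (\<forall>v. v \<notin> \<sigma> \<longrightarrow> \<alpha> v = 0) \<and> sum \<alpha> \<sigma> = 1}"

lemma closed_cell_nonempty: "\<alpha> \<in> closed_cell \<sigma> \<Longrightarrow> \<sigma> \<noteq> {}"
  by (auto simp: closed_cell_def)

lemma closed_cell_le_1:
  assumes "finite \<sigma>" "\<alpha> \<in> closed_cell \<sigma>" shows "\<alpha> v \<le> 1"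
proof (cases "v \<in> \<sigma>")
  case True
  then have "\<alpha> v \<le> sum \<alpha> \<sigma>" using assms by (intro member_le_sum) (auto simp: closed_cell_def)
  with assms show ?thesis by (simp add: closed_cell_def)
qed (use assms in \<open>auto simp: closed_cell_def\<close>)

lemma closed_cell_support:
  assumes "finite \<sigma>" "\<alpha> \<in> closed_cell \<sigma>"
  shows "{v. \<alpha> v \<noteq> 0} \<subseteq> \<sigma>" "\<alpha> \<in> closed_cell {v. \<alpha> v \<noteq> 0}"
proof -
  show s: "{v. \<alpha> v \<noteq> 0} \<subseteq> \<sigma>" using assms by (auto simp: closed_cell_def)
  have "sum \<alpha> {v. \<alpha> v \<noteq> 0} = sum \<alpha> \<sigma>"
    by (rule sum.mono_neutral_left) (use assms s in auto)
  with assms show "\<alpha> \<in> closed_cell {v. \<alpha> v \<noteq> 0}" by (auto simp: closed_cell_def)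
qed

lemma closed_cell_subset_cube:
  assumes "finite \<sigma>" "\<sigma> \<subseteq> V" shows "closed_cell \<sigma> \<subseteq> cube V"
proof
  fix \<alpha> assume "\<alpha> \<in> closed_cell \<sigma>"
  with closed_cell_le_1[OF assms(1) this] assms show "\<alpha> \<in> cube V"
    by (auto simp: closed_cell_def cube_def)
qed

text \<open>A point of the cell that vanishes outside \<open>W\<close> lies on the face \<sigma>
  \<inter> W. Hence only simplices inside \<open>W\<close> matter when a set is tested on
  \<open>cube W\<close>.\<close>

lemma closed_cell_Int_cube:
  assumes "finite \<sigma>" shows "closed_cell \<sigma> \<inter> cube W \<subseteq> closed_cell (\<sigma> \<inter> W)"
proof
  fix \<alpha> assume \<alpha>: "\<alpha> \<in> closed_cell \<sigma> \<inter> cube W"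
  have "sum \<alpha> (\<sigma> \<inter> W) = sum \<alpha> \<sigma>"
    by (rule sum.mono_neutral_left) (use assms \<alpha> in \<open>auto simp: cube_def\<close>)
  with \<alpha> show "\<alpha> \<in> closed_cell (\<sigma> \<inter> W)" by (auto simp: closed_cell_def cube_def)
qed

lemma closedin_closed_cell: "closedin (powertop_real UNIV) (closed_cell \<sigma>)"
proof -
  have eq: "closed_cell \<sigma> = (\<Inter>v. {\<alpha>. 0 \<le> \<alpha> v}) \<inter> (\<Inter>v\<in>-\<sigma>. {\<alpha>. \<alpha> v = 0}) \<inter> {\<alpha>. sum \<alpha> \<sigma> = 1}"
    by (auto simp: closed_cell_def)
  have c: "continuous_on UNIV (\<lambda>\<alpha> :: 'a \<Rightarrow> real. \<alpha> v)" for v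
    by (rule continuous_on_product_coordinates)
  have "closed (closed_cell \<sigma>)"
    unfolding eq
    by (intro closed_Int closed_INT ballI closed_Collect_le closed_Collect_eq continuous_on_const
        continuous_on_sum c)
  then show ?thesis by (simp add: euclidean_product_topology)
qed

lemma topspace_cube_topology [simp]: "topspace (cube_topology V) = cube V"
proof (cases "finite V")
  case False
  have "openin (cube_topology V) (cube V)"
    unfolding openin_cube_topology_infinite[OF False]
  proof (intro conjI allI impI)
    fix W assume "finite W \<and> W \<subseteq> V"
    then have "cube V \<inter> cube W = topspace (product_cube W)" by (auto simp: cube_def)
    then show "openin (product_cube W) (cube V \<inter> cube W)" by (simp only: openin_topspace)
  qed simp
  moreover have "topspace (cube_topology V) \<subseteq> cube V"
    using openin_topspace[of "cube_topology V"] openin_cube_topology_infinite[OF False] by blast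
  ultimately show ?thesis using openin_subset by blast
qed (simp add: cube_topology_def)

text \<open>The complement form of the weak topology. For finite \<open>V\<close> the test set
  \<open>W = V\<close> gives the product topology, so one criterion covers both cases of the
  definition.\<close>

lemma closedin_cube_topologyI:
  assumes "C \<subseteq> cube V" and C: "\<And>W. finite W \<Longrightarrow> W \<subseteq> V \<Longrightarrow> closedin (product_cube W) (C \<inter> cube W)"
  shows "closedin (cube_topology V) C"
proof (cases "finite V")
  case True
  then have "closedin (product_cube V) (C \<inter> cube V)" using C by blast
  then show ?thesis using True assms(1) by (simp add: cube_topology_def Int_absorb2)
next
  case False
  have "openin (product_cube W) ((cube V - C) \<inter> cube W)" if "finite W \<and> W \<subseteq> V" for W
  proof -
    have "(cube V - C) \<inter> cube W = topspace (product_cube W) - C \<inter> cube W"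
      using that by (auto simp: cube_def)
    with C that show ?thesis by (metis closedin_def)
  qed
  then show ?thesis
    using assms(1) by (auto simp: closedin_def openin_cube_topology_infinite[OF False])
qed

context
  fixes K :: "'a set set" and V :: "'a set"
  assumes K: "abstract_simplicial_complex K V"
begin

lemma simplex_finite: "\<sigma> \<in> K \<Longrightarrow> finite \<sigma>"
  and simplex_subset: "\<sigma> \<in> K \<Longrightarrow> \<sigma> \<subseteq> V"
  and simplex_face: "\<sigma> \<in> K \<Longrightarrow> \<tau> \<subseteq> \<sigma> \<Longrightarrow> \<tau> \<in> K"
  using K by (auto simp: abstract_simplicial_complex_def)

text \<open>The definition sorts points by their exact support; closure of \<open>K\<close> under
  subsets turns this into a cover by closed cells.\<close>

lemma topspace_complex_realization:
  "topspace (complex_realization K V) = (\<Union>\<sigma>\<in>K. closed_cell \<sigma>)"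
proof (intro equalityI subsetI)
  fix \<alpha> assume "\<alpha> \<in> topspace (complex_realization K V)"
  then have "{v. \<alpha> v \<noteq> 0} \<in> K" "\<alpha> \<in> closed_cell {v. \<alpha> v \<noteq> 0}"
    by (auto simp: complex_realization_def closed_cell_def cube_def)
  then show "\<alpha> \<in> (\<Union>\<sigma>\<in>K. closed_cell \<sigma>)" by blast
next
  fix \<alpha> assume "\<alpha> \<in> (\<Union>\<sigma>\<in>K. closed_cell \<sigma>)"
  then obtain \<sigma> where \<sigma>: "\<sigma> \<in> K" "\<alpha> \<in> closed_cell \<sigma>" by blast
  note f = simplex_finite[OF \<sigma>(1)]
  from closed_cell_support[OF f \<sigma>(2)] have "{v. \<alpha> v \<noteq> 0} \<in> K" "(\<Sum>v | \<alpha> v \<noteq> 0. \<alpha> v) = 1"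
    using simplex_face[OF \<sigma>(1)] by (auto simp: closed_cell_def)
  moreover have "\<alpha> \<in> cube V"
    using closed_cell_subset_cube[OF f simplex_subset[OF \<sigma>(1)]] \<sigma>(2) by blast
  ultimately show "\<alpha> \<in> topspace (complex_realization K V)"
    by (simp add: complex_realization_def)
qed

text \<open>A finite \<open>W\<close> contains only finitely many simplices, and the part of
  \<open>C\<close> in \<open>cube W\<close> is covered by their closed cells. It is therefore a
  finite union of closed sets, so \<open>C\<close> is closed already in the ambient cube.\<close>

lemma closedin_complex_realizationI:
  assumes C: "C \<subseteq> topspace (complex_realization K V)"
    and cl: "\<And>\<sigma>. \<sigma> \<in> K \<Longrightarrow> closedin (powertop_real UNIV) (C \<inter> closed_cell \<sigma>)"
  shows "closedin (complex_realization K V) C"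
proof -
  have "closedin (cube_topology V) C"
  proof (rule closedin_cube_topologyI)
    show "C \<subseteq> cube V" using C by (auto simp: complex_realization_def)
    fix W :: "'a set" assume W: "finite W" "W \<subseteq> V"
    have "C \<inter> cube W = (\<Union>\<sigma>\<in>{\<sigma>\<in>K. \<sigma> \<subseteq> W}. C \<inter> closed_cell \<sigma>) \<inter> cube W" (is "_ = ?U \<inter> _")
    proof (intro equalityI subsetI)
      fix \<alpha> assume \<alpha>: "\<alpha> \<in> C \<inter> cube W"
      then obtain \<sigma> where \<sigma>: "\<sigma> \<in> K" "\<alpha> \<in> closed_cell \<sigma>"
        using C topspace_complex_realization by auto
      with \<alpha> closed_cell_Int_cube[OF simplex_finite] have "\<alpha> \<in> closed_cell (\<sigma> \<inter> W)" by blast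
      moreover have "\<sigma> \<inter> W \<in> K" by (rule simplex_face[OF \<sigma>(1)]) simp
      ultimately show "\<alpha> \<in> ?U \<inter> cube W" using \<alpha> by auto
    qed auto
    moreover have "closedin (powertop_real UNIV) ?U"
      using W(1) by (intro closedin_Union) (auto simp: cl finite_subset[of _ "Pow W"])
    ultimately show "closedin (product_cube W) (C \<inter> cube W)"
      unfolding product_cube_def closedin_subtopology by blast
  qed
  then show ?thesis
    using C unfolding complex_realization_def
    by (intro closedin_subset_topspace) auto
qed

lemma continuous_map_complex_realization:
  assumes "\<And>\<sigma>. \<sigma> \<in> K \<Longrightarrow> continuous_map (subtopology (powertop_real UNIV) (closed_cell \<sigma>)) Y f"
  shows "continuous_map (complex_realization K V) Y f"
  unfolding continuous_map_closedin
proof (intro conjI allI impI Pi_I)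
  fix \<alpha> assume "\<alpha> \<in> topspace (complex_realization K V)"
  then obtain \<sigma> where "\<sigma> \<in> K" "\<alpha> \<in> closed_cell \<sigma>" by (auto simp: topspace_complex_realization)
  with assms[of \<sigma>] show "f \<alpha> \<in> topspace Y" by (auto simp: continuous_map_def)
next
  fix C assume C: "closedin Y C"
  show "closedin (complex_realization K V) {\<alpha> \<in> topspace (complex_realization K V). f \<alpha> \<in> C}"
  proof (rule closedin_complex_realizationI)
    fix \<sigma> assume \<sigma>: "\<sigma> \<in> K"
    have "{\<alpha> \<in> topspace (complex_realization K V). f \<alpha> \<in> C} \<inter> closed_cell \<sigma> =
        {\<alpha> \<in> topspace (subtopology (powertop_real UNIV) (closed_cell \<sigma>)). f \<alpha> \<in> C}"
      using \<sigma> by (auto simp: topspace_complex_realization)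
    moreover have "closedin (powertop_real UNIV) \<dots>"
      by (rule closedin_trans_full[OF closedin_continuous_map_preimage[OF assms[OF \<sigma>] C]
            closedin_closed_cell])
    ultimately show "closedin (powertop_real UNIV)
        ({\<alpha> \<in> topspace (complex_realization K V). f \<alpha> \<in> C} \<inter> closed_cell \<sigma>)"
      by simp
  qed auto
qed

text \<open>For infinite \<open>V\<close> the topology of the cube is defined by finite subcubes, so
  coordinatewise continuity is not the general criterion. It suffices here because all values lie in
  the one finite cube on \<sigma>, where the topology is the product topology.\<close>

lemma continuous_map_into_complex_realization:
  assumes \<sigma>: "\<sigma> \<in> K" and f: "continuous_map T (powertop_real UNIV) f"
    and im: "\<And>z. z \<in> topspace T \<Longrightarrow> f z \<in> closed_cell \<sigma>"
  shows "continuous_map T (complex_realization K V) f"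
proof -
  note fin = simplex_finite[OF \<sigma>] and sub = simplex_subset[OF \<sigma>]
  have imc: "f \<in> topspace T \<rightarrow> cube W" if "\<sigma> \<subseteq> W" for W
    using im closed_cell_subset_cube[OF fin that] by blast
  have pc: "continuous_map T (product_cube W) f" if "\<sigma> \<subseteq> W" for W
    using f imc[OF that] by (auto simp: product_cube_def continuous_map_in_subtopology)
  have "continuous_map T (cube_topology V) f"
  proof (cases "finite V")
    case True
    then show ?thesis using pc[OF sub] by (simp add: cube_topology_def)
  next
    case False
    show ?thesis
      unfolding continuous_map_def
    proof (intro conjI allI impI)
      fix U assume "openin (cube_topology V) U"
      then have "openin (product_cube \<sigma>) (U \<inter> cube \<sigma>)"
        using False fin sub by (simp add: openin_cube_topology_infinite)
      from openin_continuous_map_preimage[OF pc this]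
      have "openin T {z \<in> topspace T. f z \<in> U \<inter> cube \<sigma>}" by simp
      moreover have "{z \<in> topspace T. f z \<in> U \<inter> cube \<sigma>} = {z \<in> topspace T. f z \<in> U}"
        using imc[of \<sigma>] by auto
      ultimately show "openin T {z \<in> topspace T. f z \<in> U}" by simp
    qed (use imc[OF sub] in auto)
  qed
  moreover have "f z \<in> {\<alpha> \<in> cube V. {v. \<alpha> v \<noteq> 0} \<in> K \<and> (\<Sum>v | \<alpha> v \<noteq> 0. \<alpha> v) = 1}"
    if "z \<in> topspace T" for z
  proof -
    have "f z \<in> topspace (complex_realization K V)"
      using im[OF that] \<sigma> by (auto simp: topspace_complex_realization)
    then show ?thesis by (simp add: complex_realization_def)
  qed
  ultimately show ?thesis by (auto simp: complex_realization_def continuous_map_in_subtopology)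
qed

end

section \<open>Barycentric coordinates along an enumeration\<close>

text \<open>The barycentric coordinates of \<alpha> in the order of \<open>enum \<sigma>\<close>.
  The zero tail is what \<open>standard_simplex\<close> demands.\<close>

definition enum_weights :: "'a set \<Rightarrow> ('a \<Rightarrow> real) \<Rightarrow> nat \<Rightarrow> real" where
  "enum_weights \<sigma> \<alpha> i = (if i \<le> card \<sigma> - 1 then \<alpha> (enum \<sigma> i) else 0)"

text \<open>\<open>enum \<sigma>\<close> is a bijection onto a set that carries all of \<alpha>, so
  no weight is lost or merged. This identity makes the section a strict right inverse of the
  comparison map.\<close>

lemma pushforward_enum_weights:
  assumes \<sigma>: "finite \<sigma>" "\<sigma> \<noteq> {}" and \<alpha>: "\<And>v. v \<notin> \<sigma> \<Longrightarrow> \<alpha> v = 0"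
  shows "pushforward (card \<sigma> - 1) (enum \<sigma>) (enum_weights \<sigma> \<alpha>) = \<alpha>"
proof
  fix v
  have b: "inj_on (enum \<sigma>) {..card \<sigma> - 1}" "enum \<sigma> ` {..card \<sigma> - 1} = \<sigma>"
    using bij_betw_enum[OF \<sigma>] by (auto simp: bij_betw_def)
  show "pushforward (card \<sigma> - 1) (enum \<sigma>) (enum_weights \<sigma> \<alpha>) v = \<alpha> v"
  proof (cases "v \<in> \<sigma>")
    case True
    then obtain i where "i \<le> card \<sigma> - 1" "v = enum \<sigma> i" using b(2) by auto
    with pushforward_inj[OF b(1)] show ?thesis by (simp add: enum_weights_def)
  next
    case False
    with b \<alpha> show ?thesis by (simp add: pushforward_eq_0)
  qed
qed

lemma enum_weights_in_standard_simplex: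
  assumes \<sigma>: "finite \<sigma>" and \<alpha>: "\<alpha> \<in> closed_cell \<sigma>"
  shows "enum_weights \<sigma> \<alpha> \<in> standard_simplex (card \<sigma> - 1)"
proof -
  have ne: "\<sigma> \<noteq> {}" using closed_cell_nonempty[OF \<alpha>] .
  have "sum (enum_weights \<sigma> \<alpha>) {..card \<sigma> - 1} = (\<Sum>i\<le>card \<sigma> - 1. \<alpha> (enum \<sigma> i))"
    by (rule sum.cong) (auto simp: enum_weights_def)
  also have "\<dots> = sum \<alpha> \<sigma>" by (rule sum.reindex_bij_betw[OF bij_betw_enum[OF \<sigma> ne]])
  finally show ?thesis
    using \<alpha> closed_cell_le_1[OF \<sigma> \<alpha>]
    by (auto simp: standard_simplex_def closed_cell_def enum_weights_def)
qed

text \<open>Both sides have pushforward \<open>\<alpha>\<close> along the injective map \<open>enum \<sigma>\<close>.\<close>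
lemma pushforward_enum_weights_face:
  assumes \<sigma>: "finite \<sigma>" "\<tau> \<subseteq> \<sigma>" "\<tau> \<noteq> {}" and \<alpha>: "\<And>v. v \<notin> \<tau> \<Longrightarrow> \<alpha> v = 0"
    and \<iota>: "\<iota> ` {..card \<tau> - 1} \<subseteq> {..card \<sigma> - 1}" "enum \<tau> = compose {..card \<tau> - 1} (enum \<sigma>) \<iota>"
  shows "pushforward (card \<tau> - 1) \<iota> (enum_weights \<tau> \<alpha>) = enum_weights \<sigma> \<alpha>"
proof
  fix i
  have ft: "finite \<tau>" using \<sigma> finite_subset by blast
  have ne: "\<sigma> \<noteq> {}" using \<sigma> by auto
  show "pushforward (card \<tau> - 1) \<iota> (enum_weights \<tau> \<alpha>) i = enum_weights \<sigma> \<alpha> i"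
  proof (cases "i \<le> card \<sigma> - 1")
    case True
    have inj: "inj_on (enum \<sigma>) {..card \<sigma> - 1}"
      using bij_betw_enum[OF \<sigma>(1) ne] by (simp add: bij_betw_def)
    have "pushforward (card \<tau> - 1) \<iota> (enum_weights \<tau> \<alpha>) i =
        pushforward (card \<sigma> - 1) (enum \<sigma>) (pushforward (card \<tau> - 1) \<iota> (enum_weights \<tau> \<alpha>)) (enum \<sigma> i)"
      using pushforward_inj[OF inj True] by simp
    also have "\<dots> = pushforward (card \<tau> - 1) (enum \<tau>) (enum_weights \<tau> \<alpha>) (enum \<sigma> i)"
      using pushforward_compose[OF \<iota>(1)] \<iota>(2) by metis
    also have "\<dots> = \<alpha> (enum \<sigma> i)"
      using pushforward_enum_weights[OF ft \<sigma>(3) \<alpha>] by simp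
    finally show ?thesis using True by (simp add: enum_weights_def)
  next
    case False
    then have "i \<notin> \<iota> ` {..card \<tau> - 1}" using \<iota>(1) by auto
    with False show ?thesis by (simp add: pushforward_eq_0 enum_weights_def)
  qed
qed

lemma pushforward_in_closed_cell:
  assumes "t \<in> standard_simplex m" shows "pushforward m a t \<in> closed_cell (a ` {..m})"
  using assms sum_pushforward[of "a ` {..m}" a m t] pushforward_nonneg[OF assms]
  by (auto simp: closed_cell_def pushforward_eq_0 standard_simplex_def)

section \<open>Joining two simplices\<close>

text \<open>Concatenation of lists with \<open>m + 1\<close> and \<open>n + 1\<close> entries. It is
  applied to simplices and also to order-preserving maps, the second map then being shifted by
  \<open>m + 1\<close>.\<close>

definition simplex_join :: "nat \<Rightarrow> nat \<Rightarrow> (nat \<Rightarrow> 'a) \<Rightarrow> (nat \<Rightarrow> 'a) \<Rightarrow> nat \<Rightarrow> 'a" where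
  "simplex_join m n a b = (\<lambda>i\<in>{..m + n + 1}. if i \<le> m then a i else b (i - m - 1))"

text \<open>The standard simplex of dimension \<open>m + n + 1\<close> is the join of those of
  dimensions \<open>m\<close> and \<open>n\<close>; this is the point at time \<open>r\<close> on
  the segment from \<open>t\<close> to \<open>w\<close>. It vanishes beyond \<open>m + n + 1\<close>
  because \<open>w\<close> does so beyond \<open>n\<close>.\<close>

definition join_weights :: "nat \<Rightarrow> real \<Rightarrow> (nat \<Rightarrow> real) \<Rightarrow> (nat \<Rightarrow> real) \<Rightarrow> nat \<Rightarrow> real" where
  "join_weights m r t w i = (if i \<le> m then (1 - r) * t i else r * w (i - m - 1))"

lemma shift_image: "(\<lambda>i. m + 1 + i) ` {..n::nat} = {m<..m + n + 1}"
proof -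
  have "x \<in> (\<lambda>i. m + 1 + i) ` {..n}" if "m < x" "x \<le> m + n + 1" for x
    by (rule image_eqI[of _ _ "x - (m + 1)"]) (use that in auto)
  then show ?thesis by auto
qed

lemma sum_join:
  fixes f :: "nat \<Rightarrow> 'a::comm_monoid_add"
  shows "(\<Sum>i\<le>m + n + 1. f i) = (\<Sum>i\<le>m. f i) + (\<Sum>i\<le>n. f (m + 1 + i))"
proof -
  have "(\<Sum>i\<le>n. f (m + 1 + i)) = sum f {m<..m + n + 1}"
    unfolding shift_image[symmetric] by (subst sum.reindex) (auto simp: inj_on_def)
  moreover have "{..m + n + 1} = {..m} \<union> {m<..m + n + 1}" by auto
  moreover have "{..m} \<inter> {m<..m + n + 1} = {}" by auto
  ultimately show ?thesis by (metis sum.union_disjoint finite_atMost finite_greaterThanAtMost)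
qed

lemma pushforward_join:
  "pushforward (m + n + 1) (simplex_join m n a b) (join_weights m r t w) v =
     (1 - r) * pushforward m a t v + r * pushforward n b w v"
proof -
  have p: "pushforward k c u v = (\<Sum>i\<le>k. if c i = v then u i else 0)" for k c and u :: "nat \<Rightarrow> real"
    unfolding pushforward_def by (simp add: sum.inter_filter[symmetric])
  show ?thesis
    unfolding p sum_join sum_distrib_left
    by (intro arg_cong2[of _ _ _ _ "(+)"] sum.cong) (auto simp: simplex_join_def join_weights_def)
qed

lemma join_image: "simplex_join m n a b ` {..m + n + 1} = a ` {..m} \<union> b ` {..n}"
proof -
  have "{..m + n + 1} = {..m} \<union> (\<lambda>i. m + 1 + i) ` {..n}"
    unfolding shift_image by auto
  then have "simplex_join m n a b ` {..m + n + 1} =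
      simplex_join m n a b ` {..m} \<union> (\<lambda>i. simplex_join m n a b (m + 1 + i)) ` {..n}"
    by (simp add: image_Un image_image)
  also have "simplex_join m n a b ` {..m} = a ` {..m}" by (rule image_cong) (auto simp: simplex_join_def)
  also have "(\<lambda>i. simplex_join m n a b (m + 1 + i)) ` {..n} = b ` {..n}"
    by (rule image_cong) (auto simp: simplex_join_def)
  finally show ?thesis .
qed

lemma join_weights_in_standard_simplex:
  assumes "r \<in> {0..1}" and t: "t \<in> standard_simplex m" and w: "w \<in> standard_simplex n"
  shows "join_weights m r t w \<in> standard_simplex (m + n + 1)"
proof -
  have "(\<Sum>i\<le>m + n + 1. join_weights m r t w i) = (1 - r) * sum t {..m} + r * sum w {..n}"
    unfolding sum_join sum_distrib_left
    by (intro arg_cong2[of _ _ _ _ "(+)"] sum.cong) (auto simp: join_weights_def)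
  then have "(\<Sum>i\<le>m + n + 1. join_weights m r t w i) = 1"
    using t w by (simp add: standard_simplex_def)
  then show ?thesis
    using assms by (auto simp: standard_simplex_def join_weights_def mult_le_one)
qed

text \<open>Within a block monotonicity is inherited; across the blocks it holds since the first
  takes values at most \<open>m\<close> and the second values at least \<open>m + 1\<close>.\<close>

lemma join_order_op:
  assumes \<theta>: "\<theta> \<in> order_op m' m" and \<iota>: "\<iota> \<in> order_op n' n"
  shows "simplex_join m' n' \<theta> (\<lambda>i. m + 1 + \<iota> i) \<in> order_op (m' + n' + 1) (m + n + 1)"
proof -
  have \<theta>b: "\<theta> i \<le> m" if "i \<le> m'" for i using \<theta> that by (auto simp: order_op_def)
  have \<iota>b: "\<iota> i \<le> n" if "i \<le> n'" for i using \<iota> that by (auto simp: order_op_def)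
  have "mono_on {..m' + n' + 1} (simplex_join m' n' \<theta> (\<lambda>i. m + 1 + \<iota> i))"
  proof (rule mono_onI)
    fix i j assume ij: "i \<in> {..m' + n' + 1}" "j \<in> {..m' + n' + 1}" "i \<le> j"
    consider "j \<le> m'" | "i \<le> m'" "m' < j" | "m' < i" using ij by linarith
    then show "simplex_join m' n' \<theta> (\<lambda>i. m + 1 + \<iota> i) i \<le> simplex_join m' n' \<theta> (\<lambda>i. m + 1 + \<iota> i) j"
    proof cases
      case 1
      then show ?thesis using ij \<theta> by (auto simp: simplex_join_def order_op_def mono_on_def)
    next
      case 2
      then show ?thesis using ij \<theta>b[of i] by (auto simp: simplex_join_def)
    next
      case 3
      moreover have "\<iota> (i - m' - 1) \<le> \<iota> (j - m' - 1)"
        using \<iota> ij by (auto simp: order_op_def intro!: mono_onD[of "{..n'}" \<iota>])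
      ultimately show ?thesis using ij by (auto simp: simplex_join_def)
    qed
  qed
  moreover have "simplex_join m' n' \<theta> (\<lambda>i. m + 1 + \<iota> i) \<in> {..m' + n' + 1} \<rightarrow>\<^sub>E {..m + n + 1}"
  proof
    fix i assume "i \<in> {..m' + n' + 1}"
    then show "simplex_join m' n' \<theta> (\<lambda>i. m + 1 + \<iota> i) i \<in> {..m + n + 1}"
      using \<theta>b[of i] \<iota>b[of "i - m' - 1"] by (auto simp: simplex_join_def)
  qed (auto simp: simplex_join_def)
  ultimately show ?thesis by (simp add: order_op_def)
qed

text \<open>The shift by \<open>m + 1\<close> sends second block to second block, so the composition
  acts on each block separately.\<close>

lemma join_compose:
  assumes \<theta>: "\<theta> ` {..m'} \<subseteq> {..m}" and \<iota>: "\<iota> ` {..n'} \<subseteq> {..n}"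
  shows "compose {..m' + n' + 1} (simplex_join m n a b) (simplex_join m' n' \<theta> (\<lambda>i. m + 1 + \<iota> i)) =
    simplex_join m' n' (compose {..m'} a \<theta>) (compose {..n'} b \<iota>)"
proof
  fix i
  have "i \<le> m' \<Longrightarrow> \<theta> i \<le> m" "i - m' - 1 \<le> n' \<Longrightarrow> \<iota> (i - m' - 1) \<le> n" using \<theta> \<iota> by auto
  then show "compose {..m' + n' + 1} (simplex_join m n a b) (simplex_join m' n' \<theta> (\<lambda>i. m + 1 + \<iota> i)) i =
    simplex_join m' n' (compose {..m'} a \<theta>) (compose {..n'} b \<iota>) i"
    by (auto simp: simplex_join_def compose_def)
qed

lemma pushforward_join_weights:
  assumes \<theta>: "\<theta> ` {..m'} \<subseteq> {..m}"
  shows "pushforward (m' + n' + 1) (simplex_join m' n' \<theta> (\<lambda>i. m + 1 + \<iota> i)) (join_weights m' r t w) =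
    join_weights m r (pushforward m' \<theta> t) (pushforward n' \<iota> w)"
proof
  fix j
  have "pushforward m' \<theta> t j = 0" if "m < j" by (rule pushforward_eq_0) (use that \<theta> in force)
  \<comment> \<open>The shift separates the supports: for every \<open>j\<close> at most one of the
    two summands in \<open>pushforward_join\<close> survives.\<close>
  moreover have "pushforward n' (\<lambda>i. m + 1 + \<iota> i) w j = (if j \<le> m then 0 else pushforward n' \<iota> w (j - m - 1))"
    unfolding pushforward_def by (auto intro!: sum.neutral sum.cong)
  ultimately show "pushforward (m' + n' + 1) (simplex_join m' n' \<theta> (\<lambda>i. m + 1 + \<iota> i)) (join_weights m' r t w) j =
    join_weights m r (pushforward m' \<theta> t) (pushforward n' \<iota> w) j"
    unfolding pushforward_join by (auto simp: join_weights_def)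
qed

section \<open>The section and the deformation\<close>

definition section_map :: "'a set set \<Rightarrow> 'a set \<Rightarrow> ('a \<Rightarrow> real) \<Rightarrow>
    (nat \<times> (nat \<Rightarrow> 'a) \<times> (nat \<Rightarrow> real)) set" where
  "section_map K V \<alpha> = (let \<sigma> = {v. \<alpha> v \<noteq> 0} in
     realization_class (Sing K V) (card \<sigma> - 1, enum \<sigma>, enum_weights \<sigma> \<alpha>))"

text \<open>Defined on representatives, with \<sigma> the full vertex set of \<open>a\<close>, so
  that the joined simplex does not change with \<open>t\<close> or \<open>r\<close>.\<close>

definition join_homotopy :: "'a set set \<Rightarrow> 'a set \<Rightarrow> real \<Rightarrow>
    nat \<times> (nat \<Rightarrow> 'a) \<times> (nat \<Rightarrow> real) \<Rightarrow> (nat \<times> (nat \<Rightarrow> 'a) \<times> (nat \<Rightarrow> real)) set" where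
  "join_homotopy K V r = (\<lambda>(m, a, t). let \<sigma> = a ` {..m}; n = card \<sigma> - 1 in
     realization_class (Sing K V)
       (m + n + 1, simplex_join m n a (enum \<sigma>), join_weights m r t (enum_weights \<sigma> (pushforward m a t))))"

text \<open>A face identification leaves the pushforward unchanged by
  \<open>pushforward_compose\<close>; its image on a class is thus a singleton, and
  \<open>the_elem\<close> returns the element.\<close>

lemma sing_comparison_class:
  assumes a: "a \<in> cells (Sing K V) m" and t: "t \<in> standard_simplex m"
  shows "sing_comparison (realization_class (Sing K V) (m, a, t)) = pushforward m a t"
proof -
  let ?X = "Sing K V" and ?f = "\<lambda>(m, a, t). pushforward m a t"
  have p: "(m, a, t) \<in> topspace (simplex_sum ?X)" using a t by (simp add: topspace_simplex_sum)
  have "face_identification ?X p q \<Longrightarrow> ?f p = ?f q" for p q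
    by (induction rule: face_identification.induct)
      (auto simp: Sing_def pushforward_compose order_op_image)
  then have "?f q = ?f (m, a, t)" if "q \<in> realization_class ?X (m, a, t)" for q
    using that face_identification_invariant[of ?X "(m, a, t)" q ?f]
    by (simp add: realization_class_def realization_rel_def)
  moreover have "(m, a, t) \<in> realization_class ?X (m, a, t)"
    unfolding realization_class_def by (rule equiv_class_self[OF equiv_realization_rel p])
  ultimately have "?f ` realization_class ?X (m, a, t) = {?f (m, a, t)}" by blast
  then show ?thesis by (simp add: sing_comparison_def)
qed

lemma complex_realization_map_pushforward:
  assumes a: "a \<in> {..m} \<rightarrow> V"
  shows "complex_realization_map V g (pushforward m a t) = pushforward m (compose {..m} g a) t"
proof
  fix v'
  let ?S = "{i. i \<le> m \<and> g (a i) = v'}" and ?T = "{v \<in> a ` {..m}. g v = v'}"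
  \<comment> \<open>The sum over the support is enlarged to all vertices of \<open>a\<close> in the
    fibre; the added terms are zero.\<close>
  have "complex_realization_map V g (pushforward m a t) v' = (\<Sum>v\<in>?T. pushforward m a t v)"
    unfolding complex_realization_map_def
    by (rule sum.mono_neutral_left) (use a pushforward_eq_0[of _ a m t] in auto)
  also have "\<dots> = (\<Sum>v\<in>?T. sum t {i \<in> ?S. a i = v})"
    unfolding pushforward_def by (intro sum.cong refl) auto
  also have "\<dots> = sum t ?S" by (rule sum.group) auto
  also have "?S = {i. i \<le> m \<and> compose {..m} g a i = v'}" by (auto simp: compose_def)
  finally show "complex_realization_map V g (pushforward m a t) v' = pushforward m (compose {..m} g a) t v'"
    by (simp add: pushforward_def)
qed

context
  fixes K :: "'a set set" and V :: "'a set"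
  assumes K: "abstract_simplicial_complex K V"
begin

lemma enum_in_cells:
  assumes "\<sigma> \<in> K" "\<sigma> \<noteq> {}" shows "enum \<sigma> \<in> cells (Sing K V) (card \<sigma> - 1)"
proof -
  have i: "enum \<sigma> ` {..card \<sigma> - 1} = \<sigma>"
    using bij_betw_enum[OF simplex_finite[OF K assms(1)] assms(2)] by (simp add: bij_betw_def)
  moreover have "enum \<sigma> \<in> extensional {..card \<sigma> - 1}" by (simp add: enum_def)
  ultimately show ?thesis
    using simplex_subset[OF K assms(1)] assms(1) by (auto simp: Sing_def PiE_def)
qed

text \<open>The union of two simplices need not be a simplex; equality of the vertex sets is what
  keeps the join in \<open>K\<close>.\<close>

lemma join_in_cells:
  assumes a: "a \<in> cells (Sing K V) m" and b: "b \<in> cells (Sing K V) n" and im: "b ` {..n} = a ` {..m}"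
  shows "simplex_join m n a b \<in> cells (Sing K V) (m + n + 1)"
proof -
  have i: "simplex_join m n a b ` {..m + n + 1} = a ` {..m}" unfolding join_image im by (rule Un_absorb)
  have "a ` {..m} \<in> K" "a ` {..m} \<subseteq> V" using a by (auto simp: Sing_def)
  then have "simplex_join m n a b ` {..m + n + 1} \<in> K" "simplex_join m n a b \<in> {..m + n + 1} \<rightarrow> V"
    using i by (auto simp only: image_subset_iff_funcset[symmetric])
  moreover have "simplex_join m n a b \<in> extensional {..m + n + 1}" by (simp add: simplex_join_def)
  ultimately show ?thesis by (simp add: Sing_def PiE_def del: atMost_Suc)
qed

text \<open>The support of \<alpha> is a face of \<sigma>, and the map \<iota> of
  \<open>enum_face\<close> identifies the two representatives. The section thereby has one formula
  with a fixed cell on each closed cell, boundary included.\<close>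

lemma section_map_eq:
  assumes \<sigma>: "\<sigma> \<in> K" and \<alpha>: "\<alpha> \<in> closed_cell \<sigma>"
  shows "section_map K V \<alpha> =
    realization_class (Sing K V) (card \<sigma> - 1, enum \<sigma>, enum_weights \<sigma> \<alpha>)"
proof -
  let ?\<tau> = "{v. \<alpha> v \<noteq> 0}"
  note f = simplex_finite[OF K \<sigma>]
  note s = closed_cell_support[OF f \<alpha>]
  have ne: "?\<tau> \<noteq> {}" "\<sigma> \<noteq> {}" using closed_cell_nonempty[OF s(2)] closed_cell_nonempty[OF \<alpha>] by auto
  obtain \<iota> where \<iota>: "\<iota> \<in> order_op (card ?\<tau> - 1) (card \<sigma> - 1)"
    "enum ?\<tau> = compose {..card ?\<tau> - 1} (enum \<sigma>) \<iota>"
    using enum_face[OF f s(1) ne(1)] .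
  have "realization_class (Sing K V)
      (card ?\<tau> - 1, pull (Sing K V) (card ?\<tau> - 1) (card \<sigma> - 1) \<iota> (enum \<sigma>), enum_weights ?\<tau> \<alpha>) =
    realization_class (Sing K V)
      (card \<sigma> - 1, enum \<sigma>, pushforward (card ?\<tau> - 1) \<iota> (enum_weights ?\<tau> \<alpha>))"
    using finite_subset[OF s(1) f] s(2)
    by (intro realization_class_pull simplicial_set_Sing K \<iota> enum_in_cells \<sigma> ne
        enum_weights_in_standard_simplex)
  moreover have "pushforward (card ?\<tau> - 1) \<iota> (enum_weights ?\<tau> \<alpha>) = enum_weights \<sigma> \<alpha>"
    by (rule pushforward_enum_weights_face[OF f s(1) ne(1) _ order_op_image[OF \<iota>(1)] \<iota>(2)]) simp
  moreover have "pull (Sing K V) (card ?\<tau> - 1) (card \<sigma> - 1) \<iota> (enum \<sigma>) = enum ?\<tau>"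
    by (simp add: \<iota>(2) Sing_def)
  ultimately show ?thesis by (simp add: section_map_def Let_def)
qed

lemma sing_comparison_section_map:
  assumes "\<alpha> \<in> topspace (complex_realization K V)"
  shows "sing_comparison (section_map K V \<alpha>) = \<alpha>"
proof -
  obtain \<sigma> where \<sigma>: "\<sigma> \<in> K" "\<alpha> \<in> closed_cell \<sigma>"
    using assms topspace_complex_realization[OF K] by auto
  note f = simplex_finite[OF K \<sigma>(1)] and ne = closed_cell_nonempty[OF \<sigma>(2)]
  have "sing_comparison (section_map K V \<alpha>) =
      pushforward (card \<sigma> - 1) (enum \<sigma>) (enum_weights \<sigma> \<alpha>)"
    unfolding section_map_eq[OF \<sigma>]
    by (rule sing_comparison_class[OF enum_in_cells[OF \<sigma>(1) ne]
          enum_weights_in_standard_simplex[OF f \<sigma>(2)]])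
  also have "\<dots> = \<alpha>"
    by (rule pushforward_enum_weights[OF f ne]) (use \<sigma> in \<open>auto simp: closed_cell_def\<close>)
  finally show ?thesis .
qed

lemma continuous_map_section_map:
  "continuous_map (complex_realization K V) (realization (Sing K V)) (section_map K V)"
proof (rule continuous_map_complex_realization[OF K])
  fix \<sigma> assume \<sigma>: "\<sigma> \<in> K"
  show "continuous_map (subtopology (powertop_real UNIV) (closed_cell \<sigma>)) (realization (Sing K V))
      (section_map K V)"
  proof (cases "\<sigma> = {}")
    \<comment> \<open>Closure under subsets puts the empty set into every nonempty \<open>K\<close>,
      but its closed cell has no points.\<close>
    case True
    then have "closed_cell \<sigma> = {}" using closed_cell_nonempty by blast
    then show ?thesis by simp
  next
    case False
    have "continuous_map (subtopology (powertop_real UNIV) (closed_cell \<sigma>)) (realization (Sing K V))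
        (\<lambda>\<alpha>. realization_class (Sing K V) (card \<sigma> - 1, enum \<sigma>, enum_weights \<sigma> \<alpha>))"
    proof (rule continuous_map_realization_class[OF enum_in_cells[OF \<sigma> False]])
      have "continuous_map (powertop_real UNIV) euclideanreal (\<lambda>\<alpha>. enum_weights \<sigma> \<alpha> k)" for k
        unfolding enum_weights_def
        by (cases "k \<le> card \<sigma> - 1") (auto intro: continuous_map_product_projection)
      then show "continuous_map (subtopology (powertop_real UNIV) (closed_cell \<sigma>))
          (powertop_real UNIV) (enum_weights \<sigma>)"
        unfolding continuous_map_componentwise_UNIV by (blast intro: continuous_map_from_subtopology)
    qed (use enum_weights_in_standard_simplex[OF simplex_finite[OF K \<sigma>]] in auto)
    then show ?thesis by (rule continuous_map_eq) (simp add: section_map_eq[OF \<sigma>])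
  qed
qed

text \<open>With \<open>a\<close> fixed, all values lie in the closed cell of its vertex set and
  each coordinate is a finite sum of weights.\<close>

lemma continuous_map_sing_comparison:
  "continuous_map (realization (Sing K V)) (complex_realization K V) sing_comparison"
  unfolding realization_def
proof (rule continuous_compose_quotient_map[OF quotient_map_quotient_topology],
    rule continuous_map_simplex_sum_pieces[OF continuous_map_id])
  fix m a assume a: "a \<in> cells (Sing K V) m"
  let ?T = "subtopology (simplex_sum (Sing K V))
      {z \<in> topspace (simplex_sum (Sing K V)). id z \<in> {m} \<times> {a} \<times> standard_simplex m}"
  have w: "continuous_map ?T euclideanreal (\<lambda>z. snd (snd z) i)" for i
    using continuous_map_simplex_sum_weights[of "Sing K V"]
    unfolding continuous_map_componentwise_UNIV by (blast intro: continuous_map_from_subtopology)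
  have "continuous_map ?T (complex_realization K V) (\<lambda>z. pushforward m a (snd (snd z)))"
  proof (rule continuous_map_into_complex_realization[OF K])
    show "a ` {..m} \<in> K" using a by (simp add: Sing_def)
    show "continuous_map ?T (powertop_real UNIV) (\<lambda>z. pushforward m a (snd (snd z)))"
      unfolding continuous_map_componentwise_UNIV pushforward_def
      by (intro allI continuous_map_sum w) auto
  qed (auto intro: pushforward_in_closed_cell)
  then show "continuous_map ?T (complex_realization K V)
      (sing_comparison \<circ> realization_class (Sing K V))"
    by (rule continuous_map_eq) (use a in \<open>auto simp: sing_comparison_class\<close>)
qed

text \<open>The map \<theta> relates the first blocks and the \<iota> of \<open>enum_face\<close>
  the second ones; their join is a single order-preserving map that identifies the two deformed
  points at every time \<open>r\<close>.\<close>

lemma join_homotopy_face_identification: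
  assumes "face_identification (Sing K V) p q" and r: "r \<in> {0..1}"
  shows "join_homotopy K V r p = join_homotopy K V r q"
  using assms(1)
proof cases
  case (1 \<theta> m' m a t)
  define a' where "a' = compose {..m'} a \<theta>"
  define \<sigma> where "\<sigma> = a ` {..m}"
  define \<sigma>' where "\<sigma>' = a' ` {..m'}"
  define n where "n = card \<sigma> - 1"
  define n' where "n' = card \<sigma>' - 1"
  define \<alpha> where "\<alpha> = pushforward m' a' t"
  note \<theta> = order_op_image[OF 1(3)]
  have p: "p = (m', a', t)" by (simp add: 1 a'_def Sing_def)
  \<comment> \<open>Both representatives determine the same point \<alpha>, although \<sigma>' is
    smaller than \<sigma> when \<theta> misses vertices.\<close>
  have \<alpha>2: "\<alpha> = pushforward m a (pushforward m' \<theta> t)"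
    unfolding \<alpha>_def a'_def by (rule pushforward_compose[OF \<theta>])
  have \<sigma>: "\<sigma> \<in> K" using 1 by (simp add: \<sigma>_def Sing_def)
  have sub: "\<sigma>' \<subseteq> \<sigma>" using \<theta> by (auto simp: \<sigma>_def \<sigma>'_def a'_def compose_def)
  have ne: "\<sigma>' \<noteq> {}" "\<sigma> \<noteq> {}" by (auto simp: \<sigma>_def \<sigma>'_def)
  note f = simplex_finite[OF K \<sigma>]
  have f': "finite \<sigma>'" by (simp add: \<sigma>'_def)
  have \<alpha>: "\<alpha> \<in> closed_cell \<sigma>'" unfolding \<alpha>_def \<sigma>'_def by (rule pushforward_in_closed_cell[OF 1(5)])
  obtain \<iota> where \<iota>: "\<iota> \<in> order_op n' n" "enum \<sigma>' = compose {..n'} (enum \<sigma>) \<iota>"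
    using enum_face[OF f sub ne(1)] unfolding n_def n'_def .
  have im: "enum \<sigma> ` {..n} = a ` {..m}"
    using bij_betw_enum[OF f ne(2)] by (simp add: bij_betw_def n_def \<sigma>_def)
  let ?\<Theta> = "simplex_join m' n' \<theta> (\<lambda>i. m + 1 + \<iota> i)"
  have "realization_class (Sing K V) (m' + n' + 1,
        pull (Sing K V) (m' + n' + 1) (m + n + 1) ?\<Theta> (simplex_join m n a (enum \<sigma>)),
        join_weights m' r t (enum_weights \<sigma>' \<alpha>)) =
      realization_class (Sing K V) (m + n + 1, simplex_join m n a (enum \<sigma>),
        pushforward (m' + n' + 1) ?\<Theta> (join_weights m' r t (enum_weights \<sigma>' \<alpha>)))"
  proof (rule realization_class_pull[OF simplicial_set_Sing[OF K] join_order_op[OF 1(3) \<iota>(1)]])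
    show "simplex_join m n a (enum \<sigma>) \<in> cells (Sing K V) (m + n + 1)"
      using enum_in_cells[OF \<sigma> ne(2)] by (intro join_in_cells 1(4) im) (simp add: n_def)
    show "join_weights m' r t (enum_weights \<sigma>' \<alpha>) \<in> standard_simplex (m' + n' + 1)"
      using enum_weights_in_standard_simplex[OF f' \<alpha>]
      by (intro join_weights_in_standard_simplex r 1(5)) (simp add: n'_def)
  qed
  moreover have "pull (Sing K V) (m' + n' + 1) (m + n + 1) ?\<Theta> (simplex_join m n a (enum \<sigma>)) =
      simplex_join m' n' a' (enum \<sigma>')"
    using join_compose[OF \<theta> order_op_image[OF \<iota>(1)], of a "enum \<sigma>"]
    by (simp add: Sing_def a'_def \<iota>(2) del: atMost_Suc)
  moreover have "pushforward n' \<iota> (enum_weights \<sigma>' \<alpha>) = enum_weights \<sigma> \<alpha>"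
    unfolding n'_def
    by (rule pushforward_enum_weights_face[OF f sub ne(1)])
      (use \<alpha> \<iota> order_op_image[OF \<iota>(1)] in \<open>auto simp: closed_cell_def n_def n'_def\<close>)
  moreover have "join_homotopy K V r p = realization_class (Sing K V)
      (m' + n' + 1, simplex_join m' n' a' (enum \<sigma>'), join_weights m' r t (enum_weights \<sigma>' \<alpha>))"
    by (simp only: p join_homotopy_def Let_def prod.case \<sigma>'_def n'_def \<alpha>_def)
  moreover have "join_homotopy K V r q = realization_class (Sing K V)
      (m + n + 1, simplex_join m n a (enum \<sigma>),
        join_weights m r (pushforward m' \<theta> t) (enum_weights \<sigma> \<alpha>))"
    by (simp only: 1(2) join_homotopy_def Let_def prod.case \<sigma>_def n_def \<alpha>2)
  ultimately show ?thesis by (simp only: pushforward_join_weights[OF \<theta>])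
qed

lemma join_homotopy_0_1:
  assumes a: "a \<in> cells (Sing K V) m" and t: "t \<in> standard_simplex m"
  shows "join_homotopy K V 0 (m, a, t) = realization_class (Sing K V) (m, a, t)"
    and "join_homotopy K V 1 (m, a, t) = section_map K V (pushforward m a t)"
proof -
  define \<sigma> where "\<sigma> = a ` {..m}"
  define n where "n = card \<sigma> - 1"
  define w where "w = enum_weights \<sigma> (pushforward m a t)"
  have \<sigma>: "\<sigma> \<in> K" "\<sigma> \<noteq> {}" using a by (auto simp: \<sigma>_def Sing_def)
  note f = simplex_finite[OF K \<sigma>(1)]
  have \<alpha>: "pushforward m a t \<in> closed_cell \<sigma>"
    unfolding \<sigma>_def by (rule pushforward_in_closed_cell[OF t])
  have w: "w \<in> standard_simplex n"
    unfolding w_def n_def by (rule enum_weights_in_standard_simplex[OF f \<alpha>])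
  have e: "enum \<sigma> \<in> cells (Sing K V) n" unfolding n_def by (rule enum_in_cells[OF \<sigma>])
  have im: "enum \<sigma> ` {..n} = a ` {..m}"
    using bij_betw_enum[OF f \<sigma>(2)] by (simp add: bij_betw_def n_def \<sigma>_def)
  note j = join_in_cells[OF a e im]
  have h: "join_homotopy K V r (m, a, t) = realization_class (Sing K V)
      (m + n + 1, simplex_join m n a (enum \<sigma>), join_weights m r t w)" for r
    by (simp add: join_homotopy_def Let_def \<sigma>_def n_def w_def)
  show "join_homotopy K V 0 (m, a, t) = realization_class (Sing K V) (m, a, t)"
  proof -
    \<comment> \<open>The inclusion of the front face, where all the weight sits at
      \<open>r = 0\<close>.\<close>
    let ?\<theta> = "\<lambda>i\<in>{..m}. i"
    have "?\<theta> \<in> order_op m (m + n + 1)" by (auto simp: order_op_def mono_on_def)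
    from realization_class_pull[OF simplicial_set_Sing[OF K] this j t]
    have "realization_class (Sing K V)
        (m, pull (Sing K V) m (m + n + 1) ?\<theta> (simplex_join m n a (enum \<sigma>)), t) =
      realization_class (Sing K V) (m + n + 1, simplex_join m n a (enum \<sigma>), pushforward m ?\<theta> t)" .
    moreover have "pull (Sing K V) m (m + n + 1) ?\<theta> (simplex_join m n a (enum \<sigma>)) = a"
      using a by (auto simp: Sing_def compose_def simplex_join_def fun_eq_iff PiE_def extensional_def)
    moreover have "pushforward m ?\<theta> t = join_weights m 0 t w"
    proof
      fix i
      have "{k. k \<le> m \<and> ?\<theta> k = i} = (if i \<le> m then {i} else {})" by auto
      then show "pushforward m ?\<theta> t i = join_weights m 0 t w i"
        by (simp add: pushforward_def join_weights_def)
    qed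
    ultimately show ?thesis by (simp add: h)
  qed
  show "join_homotopy K V 1 (m, a, t) = section_map K V (pushforward m a t)"
  proof -
    \<comment> \<open>The inclusion of the back face, which carries the enumeration and, at
      \<open>r = 1\<close>, all the weight.\<close>
    let ?\<theta> = "\<lambda>i\<in>{..n}. m + 1 + i"
    have "?\<theta> \<in> order_op n (m + n + 1)" by (auto simp: order_op_def mono_on_def)
    from realization_class_pull[OF simplicial_set_Sing[OF K] this j w]
    have "realization_class (Sing K V)
        (n, pull (Sing K V) n (m + n + 1) ?\<theta> (simplex_join m n a (enum \<sigma>)), w) =
      realization_class (Sing K V) (m + n + 1, simplex_join m n a (enum \<sigma>), pushforward n ?\<theta> w)" .
    moreover have "pull (Sing K V) n (m + n + 1) ?\<theta> (simplex_join m n a (enum \<sigma>)) = enum \<sigma>"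
      using e by (auto simp: Sing_def compose_def simplex_join_def fun_eq_iff PiE_def extensional_def)
    moreover have "pushforward n ?\<theta> w = join_weights m 1 t w"
    proof
      fix i
      have "{k. k \<le> n \<and> ?\<theta> k = i} = (if m < i \<and> i \<le> m + n + 1 then {i - m - 1} else {})" by auto
      then show "pushforward n ?\<theta> w i = join_weights m 1 t w i"
        using w by (auto simp: pushforward_def join_weights_def standard_simplex_def)
    qed
    ultimately show ?thesis
      unfolding h section_map_eq[OF \<sigma>(1) \<alpha>] n_def[symmetric] w_def[symmetric] by simp
  qed
qed

text \<open>On the piece of one cell \<open>a\<close> the joined simplex is constant, and its
  weights are polynomial in \<open>r\<close> and the coordinates of \<open>t\<close>.\<close>

lemma continuous_map_join_homotopy:
  "continuous_map (prod_topology (top_of_set {0..1}) (simplex_sum (Sing K V))) (realization (Sing K V))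
     (\<lambda>(r, p). join_homotopy K V r p)"
proof (rule continuous_map_simplex_sum_pieces[OF continuous_map_snd])
  fix m a assume a: "a \<in> cells (Sing K V) m"
  let ?P = "prod_topology (top_of_set {0..1::real}) (simplex_sum (Sing K V))"
  let ?T = "subtopology ?P {z \<in> topspace ?P. snd z \<in> {m} \<times> {a} \<times> standard_simplex m}"
  define \<sigma> where "\<sigma> = a ` {..m}"
  define n where "n = card \<sigma> - 1"
  define u where "u z = join_weights m (fst z) (snd (snd (snd z)))
      (enum_weights \<sigma> (pushforward m a (snd (snd (snd z)))))"
    for z :: "real \<times> nat \<times> (nat \<Rightarrow> 'a) \<times> (nat \<Rightarrow> real)"
  have \<sigma>: "\<sigma> \<in> K" "\<sigma> \<noteq> {}" using a by (auto simp: \<sigma>_def Sing_def)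
  note f = simplex_finite[OF K \<sigma>(1)]
  have im: "enum \<sigma> ` {..n} = a ` {..m}"
    using bij_betw_enum[OF f \<sigma>(2)] by (simp add: bij_betw_def n_def \<sigma>_def)
  have e: "enum \<sigma> \<in> cells (Sing K V) n" unfolding n_def by (rule enum_in_cells[OF \<sigma>])
  have fst: "continuous_map ?T euclideanreal fst"
    using continuous_map_fst[of "top_of_set {0..1::real}" "simplex_sum (Sing K V)"]
    by (intro continuous_map_from_subtopology) (simp add: continuous_map_in_subtopology)
  have "continuous_map ?P (powertop_real UNIV) (\<lambda>z. snd (snd (snd z)))"
    using continuous_map_compose[OF continuous_map_snd continuous_map_simplex_sum_weights[of "Sing K V"]]
    by (simp add: o_def)
  then have w: "continuous_map ?T euclideanreal (\<lambda>z. snd (snd (snd z)) i)" for i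
    unfolding continuous_map_componentwise_UNIV by (blast intro: continuous_map_from_subtopology)
  have "continuous_map ?T (realization (Sing K V))
      (\<lambda>z. realization_class (Sing K V) (m + n + 1, simplex_join m n a (enum \<sigma>), u z))"
  proof (rule continuous_map_realization_class[OF join_in_cells[OF a e im]])
    show "continuous_map ?T (powertop_real UNIV) u"
      unfolding continuous_map_componentwise_UNIV u_def join_weights_def enum_weights_def pushforward_def
      by (intro allI continuous_map_if continuous_map_real_mult continuous_map_diff
          continuous_map_const[THEN iffD2] continuous_map_sum fst w) auto
    show "u z \<in> standard_simplex (m + n + 1)" if "z \<in> topspace ?T" for z
      unfolding u_def n_def
    proof (intro join_weights_in_standard_simplex enum_weights_in_standard_simplex f)
      show "pushforward m a (snd (snd (snd z))) \<in> closed_cell \<sigma>"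
        unfolding \<sigma>_def by (rule pushforward_in_closed_cell) (use that in auto)
    qed (use that in auto)
  qed
  then show "continuous_map ?T (realization (Sing K V)) (\<lambda>(r, p). join_homotopy K V r p)"
    by (rule continuous_map_eq)
      (auto simp: join_homotopy_def Let_def u_def n_def \<sigma>_def)
qed

lemma homotopic_section_map_sing_comparison:
  "homotopic_with (\<lambda>_. True) (realization (Sing K V)) (realization (Sing K V))
     (section_map K V \<circ> sing_comparison) id"
proof -
  let ?X = "Sing K V"
  let ?I = "top_of_set {0..1::real}"
  have "locally_compact_space ?I" "Hausdorff_space ?I"
    by (auto intro!: compact_imp_locally_compact_space Hausdorff_space_subtopology
        simp: compact_space_subtopology)
  then have q: "quotient_map (prod_topology ?I (simplex_sum ?X)) (prod_topology ?I (realization ?X))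
      (\<lambda>(r, p). (r, realization_class ?X p))"
    unfolding realization_def
    by (intro quotient_map_prod_right quotient_map_quotient_topology disjI1)
  \<comment> \<open>Points with equal image share the time \<open>r\<close>, and their
    representatives are linked by a chain of face identifications, each of which preserves
    \<open>join_homotopy\<close> at time \<open>r\<close>.\<close>
  have inv: "(\<lambda>(r, p). join_homotopy K V r p) x = (\<lambda>(r, p). join_homotopy K V r p) y"
    if x: "x \<in> topspace (prod_topology ?I (simplex_sum ?X))"
    and y: "y \<in> topspace (prod_topology ?I (simplex_sum ?X))"
    and xy: "(\<lambda>(r, p). (r, realization_class ?X p)) x = (\<lambda>(r, p). (r, realization_class ?X p)) y"
    for x y
  proof -
    have eq: "equivclp (face_identification ?X) (snd x) (snd y)"
      by (rule realization_class_eqD) (use x y xy in auto)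
    have "fst x \<in> {0..1}" using x by auto
    then have "join_homotopy K V (fst x) (snd x) = join_homotopy K V (fst x) (snd y)"
      using face_identification_invariant[OF eq, of "join_homotopy K V (fst x)"]
        join_homotopy_face_identification by blast
    then show ?thesis using xy by (simp add: case_prod_beta)
  qed
  obtain H where H: "continuous_map (prod_topology ?I (realization ?X)) (realization ?X) H"
    "\<forall>x\<in>topspace (prod_topology ?I (simplex_sum ?X)).
      H ((\<lambda>(r, p). (r, realization_class ?X p)) x) = (\<lambda>(r, p). join_homotopy K V r p) x"
  proof (rule quotient_map_lift_exists[OF q continuous_map_join_homotopy inv])
    fix G assume "continuous_map (prod_topology ?I (realization ?X)) (realization ?X) G"
      and "\<And>x. x \<in> topspace (prod_topology ?I (simplex_sum ?X)) \<Longrightarrow>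
        G ((\<lambda>(r, p). (r, realization_class ?X p)) x) = (\<lambda>(r, p). join_homotopy K V r p) x"
    then show thesis by (intro that[of G] ballI)
  qed
  have H': "H (r, realization_class ?X (m, a, t)) = join_homotopy K V r (m, a, t)"
    if "r \<in> {0..1}" "a \<in> cells ?X m" "t \<in> standard_simplex m" for r m a t
    using bspec[OF H(2), of "(r, m, a, t)"] that by (simp add: topspace_simplex_sum)
  \<comment> \<open>The deformation begins at the identity, so this direction comes out directly and
    is reversed at the end.\<close>
  have "homotopic_with (\<lambda>_. True) (realization ?X) (realization ?X) id
      (section_map K V \<circ> sing_comparison)"
  proof (subst homotopic_with, simp, intro exI[of _ H] conjI ballI H(1) TrueI)
    fix c assume "c \<in> topspace (realization ?X)"
    then obtain m a t where c: "c = realization_class ?X (m, a, t)"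
      and a: "a \<in> cells ?X m" and t: "t \<in> standard_simplex m"
      by (auto simp: realization_def topspace_simplex_sum)
    show "H (0, c) = id c" "H (1, c) = (section_map K V \<circ> sing_comparison) c"
      using a t by (simp_all add: c H' join_homotopy_0_1 sing_comparison_class)
  qed
  then show ?thesis by (rule homotopic_with_symD)
qed

end

theorem corollary6p7:
  fixes K :: "'a set set" and V :: "'a set"
  assumes "abstract_simplicial_complex K V"
  shows
    "(\<forall>m. \<forall>a\<in>cells (Sing K V) m. \<forall>t\<in>standard_simplex m.
        sing_comparison (realization_class (Sing K V) (m, a, t)) = pushforward m a t) \<and>
     homotopy_equivalence_map (realization (Sing K V)) (complex_realization K V) sing_comparison \<and>
     (\<forall>(K' :: 'b set set) V' g.
        abstract_simplicial_complex K' V' \<and> simplicial_map K V K' V' g \<longrightarrow>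
        (\<forall>c\<in>topspace (realization (Sing K V)).
           sing_comparison (realization_map (Sing K' V') (Sing_map g) c) =
           complex_realization_map V g (sing_comparison c)))"
proof (intro conjI allI impI ballI)
  show "homotopy_equivalence_map (realization (Sing K V)) (complex_realization K V) sing_comparison"
    unfolding homotopy_equivalence_map_def
  proof (intro conjI exI[of _ "section_map K V"])
    show "homotopic_with (\<lambda>_. True) (complex_realization K V) (complex_realization K V)
        (sing_comparison \<circ> section_map K V) id"
      \<comment> \<open>The composite equals the identity at every point of the space.\<close>
      by (rule homotopic_with_equal)
        (auto intro!: continuous_map_compose[OF continuous_map_section_map[OF assms]
            continuous_map_sing_comparison[OF assms]]
          simp: sing_comparison_section_map[OF assms])
  qed (rule continuous_map_sing_comparison[OF assms] continuous_map_section_map[OF assms]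
      homotopic_section_map_sing_comparison[OF assms])+
next
  fix K' :: "'b set set" and V' g c
  assume g: "abstract_simplicial_complex K' V' \<and> simplicial_map K V K' V' g"
    and "c \<in> topspace (realization (Sing K V))"
  then obtain m a t where c: "c = realization_class (Sing K V) (m, a, t)"
    and a: "a \<in> cells (Sing K V) m" and t: "t \<in> standard_simplex m"
    by (auto simp: realization_def topspace_simplex_sum)
  have f: "simplicial_set_map (Sing K V) (Sing K' V') (Sing_map g)"
    using g by (blast intro: simplicial_set_map_Sing)
  then have ga: "Sing_map g m a \<in> cells (Sing K' V') m"
    using a by (auto simp: simplicial_set_map_def)
  have "a \<in> {..m} \<rightarrow> V" using a by (auto simp: Sing_def)
  from complex_realization_map_pushforward[OF this, of g t]
  show "sing_comparison (realization_map (Sing K' V') (Sing_map g) c) =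
      complex_realization_map V g (sing_comparison c)"
    unfolding c realization_map_class[OF f a t] sing_comparison_class[OF ga t]
      sing_comparison_class[OF a t]
    by (simp add: Sing_map_def)
qed (rule sing_comparison_class)

end
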